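(* Let $s\in\mathbb{N}$ and let $k\in\mathbb{Z}$ be arbitrary. Then: (a) for integers $n\in[1,s]$, $$e(A_n^{\rm Tay\text{-}Per})\le\frac1{2^{n-1}\,n!};$$ (b) for integers $n\ge2s$, $$e(A_n^{\rm Tay\text{-}Per})\le\left(\frac3{2\pi}\right)^s\frac{2}{(n-2s+1+|k|)^s}.$$
   Context: For $s\in\mathbb{N}=\{1,2,\dots\}$ let $H^s=\{f:[0,1]\to\mathbb{C} : f^{(s-1)}\text{ is absolutely continuous},\ f^{(s)}\in L_2([0,1])\}$ with inner product $$\langle f,g\rangle_s=\sum_{\ell=0}^{s-1}\int_0^1 f^{(\ell)}(x)\,dx\ \int_0^1\overline{g^{(\ell)}(x)}\,dx+\int_0^1 f^{(s)}(x)\,\overline{g^{(s)}(x)}\,dx$$ and norm $\|f\|_{H^s}=\langle f,f\rangle_s^{1/2}$. The periodic subspace is $\widetilde H^s=\{f\in H^s : f^{(\ell)}(0)=f^{(\ell)}(1)\text{ for }\ell=0,\dots,s-1\}$. For $k\in\mathbb{Z}$, $I_k(f)=\int_0^1 f(x)\,e^{-2\pi i kx}\,dx$. For an algorithm $A:H^s\to\mathbb{C}$, $e(A)=\sup\{|I_k(f)-A(f)| : f\in H^s,\ \|f\|_{H^s}\le1\}$. $B_m^*=B_m/m!$ denotes the normalized Bernoulli polynomial ($B_m$ being the Bernoulli polynomial of degree $m$, the unique polynomial with $\int_t^{t+1}B_m(x)\,dx=t^m$ for all $t\in\mathbb{R}$). For $f\in H^s$ put $p_{f,s}(x)=\sum_{m=0}^{s-1}\bigl(f^{(m)}(1)-f^{(m)}(0)\bigr)B_{m+1}^*(x)$;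 then $f-p_{f,s}\in\widetilde H^s$. For $g\in\widetilde H^s$ and $n\in\{0,1,\dots\}$ let $A_n^*(g)=0$ if $n=0$ or $n<2|k|$, and $A_n^*(g)=\frac1n\sum_{j=1}^n g(j/n)\,e^{-2\pi i kj/n}$ if $n\ge\max(1,2|k|)$. For $1\le n\le s$ let $T_{f,n}(x)=\sum_{\ell=0}^{n-1}\frac{f^{(\ell)}(1/2)}{\ell!}(x-\tfrac12)^\ell$ be the Taylor polynomial of $f$ at $\tfrac12$. The algorithm $A_n^{\rm Tay\text{-}Per}$ is defined by $A_n^{\rm Tay\text{-}Per}(f)=I_k(T_{f,n})$ for $n\in[1,s]$, and $A_n^{\rm Tay\text{-}Per}(f)=I_k(p_{f,s})+A_{\ell+1}^*(f-p_{f,s})$ for $n=2s+\ell$ with $\ell\in\{0,1,2,\dots\}$. *)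

theory Defs
  imports "HOL-Analysis.Analysis"
begin

text \<open>
  A function on \<open>[0,1]\<close> is represented by a total function on the reals. Everything below
  depends only on its restriction to \<open>[0,1]\<close>; derivatives are taken relative to \<open>[0,1]\<close>, hence
  one-sided at the endpoints.
\<close>

primrec nderiv :: "nat \<Rightarrow> (real \<Rightarrow> complex) \<Rightarrow> real \<Rightarrow> complex" where
  "nderiv 0 f = f"
| "nderiv (Suc n) f = (\<lambda>x. vector_derivative (nderiv n f) (at x within {0..1}))"

definition abs_continuous_on :: "real \<Rightarrow> real \<Rightarrow> (real \<Rightarrow> complex) \<Rightarrow> bool" where
  "abs_continuous_on a b f \<longleftrightarrow>
    (\<forall>\<epsilon>>0. \<exists>\<delta>>0. \<forall>D :: (real \<times> real) set.
      finite D \<longrightarrow>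
      (\<forall>(u, v)\<in>D. a \<le> u \<and> u < v \<and> v \<le> b) \<longrightarrow>
      disjoint_family_on (\<lambda>(u, v). {u<..<v}) D \<longrightarrow>
      (\<Sum>(u, v)\<in>D. v - u) < \<delta> \<longrightarrow>
      (\<Sum>(u, v)\<in>D. norm (f v - f u)) < \<epsilon>)"

text \<open>
  For \<open>s \<ge> 1\<close>: the derivatives of order up to \<open>s - 1\<close> exist at every point of \<open>[0,1]\<close>. The
  derivative of order \<open>s\<close> exists only almost everywhere (by absolute continuity of the previous
  one); \<^const>\<open>vector_derivative\<close> has an unspecified value on the exceptional null set, which
  does not affect any of the integrals.
\<close>

definition Hspace :: "nat \<Rightarrow> (real \<Rightarrow> complex) set" where
  "Hspace s = {f.
     (\<forall>l. Suc l < s \<longrightarrow> (\<forall>x\<in>{0..1}. nderiv l f differentiable (at x within {0..1}))) \<and>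
     abs_continuous_on 0 1 (nderiv (s - 1) f) \<and>
     set_borel_measurable lebesgue {0..1} (nderiv s f) \<and>
     set_integrable lebesgue {0..1} (\<lambda>x. (cmod (nderiv s f x))\<^sup>2)}"

definition Hinner :: "nat \<Rightarrow> (real \<Rightarrow> complex) \<Rightarrow> (real \<Rightarrow> complex) \<Rightarrow> complex" where
  "Hinner s f g =
     (\<Sum>l<s. (LINT x:{0..1}|lebesgue. nderiv l f x) * (LINT x:{0..1}|lebesgue. cnj (nderiv l g x))) +
     (LINT x:{0..1}|lebesgue. nderiv s f x * cnj (nderiv s g x))"

definition Hnorm :: "nat \<Rightarrow> (real \<Rightarrow> complex) \<Rightarrow> real" where
  "Hnorm s f = sqrt (Re (Hinner s f f))"

definition fourier_int :: "int \<Rightarrow> (real \<Rightarrow> complex) \<Rightarrow> complex" where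
  "fourier_int k f =
     (LINT x:{0..1}|lebesgue. f x * exp (- 2 * of_real pi * \<i> * of_int k * of_real x))"

text \<open>The supremum is taken in the extended reals, so that an unbounded error is \<open>\<infinity>\<close>.\<close>

definition worst_error :: "nat \<Rightarrow> int \<Rightarrow> ((real \<Rightarrow> complex) \<Rightarrow> complex) \<Rightarrow> ereal" where
  "worst_error s k A =
     (SUP f \<in> {f \<in> Hspace s. Hnorm s f \<le> 1}. ereal (cmod (fourier_int k f - A f)))"

definition bernoulli_poly :: "nat \<Rightarrow> real poly" where
  "bernoulli_poly m = (THE p. \<forall>t. (LINT x:{t..t+1}|lebesgue. poly p x) = t ^ m)"

definition bernoulli_normalized :: "nat \<Rightarrow> real \<Rightarrow> real" where
  "bernoulli_normalized m x = poly (bernoulli_poly m) x / fact m"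

definition periodizer :: "nat \<Rightarrow> (real \<Rightarrow> complex) \<Rightarrow> real \<Rightarrow> complex" where
  "periodizer s f x =
     (\<Sum>m<s. (nderiv m f 1 - nderiv m f 0) * of_real (bernoulli_normalized (m + 1) x))"

definition periodic_alg :: "int \<Rightarrow> nat \<Rightarrow> (real \<Rightarrow> complex) \<Rightarrow> complex" where
  "periodic_alg k n g =
     (if n = 0 \<or> int n < 2 * \<bar>k\<bar> then 0
      else 1 / of_nat n *
        (\<Sum>j=1..n. g (real j / real n) *
           exp (- 2 * of_real pi * \<i> * of_int k * of_nat j / of_nat n)))"

definition taylor_mid :: "nat \<Rightarrow> (real \<Rightarrow> complex) \<Rightarrow> real \<Rightarrow> complex" where
  "taylor_mid n f x = (\<Sum>l<n. nderiv l f (1/2) / fact l * of_real ((x - 1/2) ^ l))"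

text \<open>The algorithm is specified only for \<open>1 \<le> n \<le> s\<close> and for \<open>n \<ge> 2 * s\<close>.\<close>

definition tay_per :: "nat \<Rightarrow> int \<Rightarrow> nat \<Rightarrow> (real \<Rightarrow> complex) \<Rightarrow> complex" where
  "tay_per s k n f =
     (if 1 \<le> n \<and> n \<le> s then fourier_int k (taylor_mid n f)
      else if 2 * s \<le> n then
        fourier_int k (periodizer s f) +
        periodic_alg k (n - 2 * s + 1) (\<lambda>x. f x - periodizer s f x)
      else undefined)"

end

theory Submission
  imports Defs
begin

text \<open>
  Both parts reduce to estimates for the derivatives \<open>F l\<close> of a function \<open>f\<close> in the unit ball of
  \<open>H\<^sup>s\<close>. The analytic input is the fundamental theorem of calculus for absolutely continuous
  functions (\<open>abs_continuous_fundamental_theorem\<close>): such a function is differentiable almost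
  everywhere and is the integral of its derivative. It is obtained by splitting a real function into
  increasing parts by means of its positive variation, applying the Radon-Nikodym theorem to their
  Stieltjes measures, and differentiating the resulting indefinite integrals almost everywhere.

  Since a Poincare inequality bounds \<open>\<parallel>F l\<parallel>\<^sup>2\<close> by \<open>|\<integral> F l|\<^sup>2 + \<parallel>F (Suc l)\<parallel>\<^sup>2\<close>, and the norm of \<open>H\<^sup>s\<close> adds up
  exactly these squared means, every derivative has \<open>L\<^sup>2\<close> norm at most \<open>1\<close>
  (\<open>unit_ball_energy_le_1\<close>). For part (a) this bounds the oscillation of \<open>F (n - 1)\<close> by \<open>1\<close>;
  integrating outward from \<open>1/2\<close> shows that the Taylor remainder at \<open>x\<close> is at most
  \<open>|x - 1/2|\<^bsup>n-1\<^esup> / (n - 1)!\<close>, and the integral of this function is the claimed bound.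

  For part (b) the periodizer is integrated exactly, so only the error of the rectangle rule for the
  periodic function \<open>g = f - periodizer s f\<close> matters, and \<open>\<parallel>g\<^sup>(\<^sup>s\<^sup>)\<parallel> \<le> \<parallel>f\<^sup>(\<^sup>s\<^sup>)\<parallel> \<le> 1\<close> because \<open>g\<^sup>(\<^sup>s\<^sup>)\<close>
  is \<open>f\<^sup>(\<^sup>s\<^sup>)\<close> minus its mean (\<open>periodized_chain\<close>). The rule with \<open>N\<close> points confuses the frequency
  \<open>k\<close> with its aliases \<open>k + j N\<close>. Its error is minus the sum of the Fourier coefficients of \<open>g\<close> at the
  aliases with \<open>j \<noteq> 0\<close>, and each of these is a coefficient of \<open>g\<^sup>(\<^sup>s\<^sup>)\<close> divided by
  \<open>(2 \<pi> i (k + j N))\<^sup>s\<close>. By the Cauchy-Schwarz inequality the error is at most the \<open>\<ell>\<^sup>2\<close> norm of these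
  factors, and \<open>|k + j N| \<ge> (N + |k|) (2 |j| - 1) / 3\<close> makes it at most
  \<open>2 (3 / (2 \<pi> (N + |k|)))\<^sup>s\<close>.

  The aliasing formula enters in a smoothed form. The mean of the samples is the limit of integrals
  of \<open>g(x) e\<^bsup>-2\<pi>ikx\<^esup>\<close> against the nonnegative trigonometric polynomials \<open>peak_kernel M (N x)\<close>, for
  which every sum over aliases is finite and carries weights in \<open>[0, 1]\<close>; the estimate is uniform in
  the degree and passes to the limit (\<open>filtered_alias_error\<close>, \<open>sampling_tendsto\<close>). When \<open>N < 2 |k|\<close>
  the rule returns \<open>0\<close> and the decay of a single Fourier coefficient is enough.
\<close>

section \<open>Families of non-overlapping intervals\<close>

text \<open>
  Absolute continuity is tested on these families. The total length of a family is the increase of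
  the identity over it, so one function serves both for lengths and for variations.
\<close>

definition interval_family :: "real \<Rightarrow> real \<Rightarrow> (real \<times> real) set \<Rightarrow> bool" where
  "interval_family a b D \<longleftrightarrow> finite D \<and> (\<forall>(u, v)\<in>D. a \<le> u \<and> u < v \<and> v \<le> b) \<and>
     disjoint_family_on (\<lambda>(u, v). {u<..<v}) D"

definition family_incr :: "(real \<Rightarrow> real) \<Rightarrow> (real \<times> real) set \<Rightarrow> real" where
  "family_incr F D = (\<Sum>(u, v)\<in>D. F v - F u)"

lemma abs_continuous_on_alt:
  "abs_continuous_on a b f \<longleftrightarrow>
    (\<forall>\<epsilon>>0. \<exists>\<delta>>0. \<forall>D. interval_family a b D \<longrightarrow> family_incr (\<lambda>x. x) D < \<delta> \<longrightarrow>
      (\<Sum>(u, v)\<in>D. norm (f v - f u)) < \<epsilon>)"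
  unfolding abs_continuous_on_def interval_family_def family_incr_def by (simp only: imp_conjL)

text \<open>
  Disjointness is used in the order form \<open>v \<le> u' \<or> v' \<le> u\<close>, which arithmetic can handle.
\<close>

lemma interval_familyD:
  assumes "interval_family a b D"
  shows "finite D" "(u, v) \<in> D \<Longrightarrow> a \<le> u" "(u, v) \<in> D \<Longrightarrow> u < v" "(u, v) \<in> D \<Longrightarrow> v \<le> b"
    "(u, v) \<in> D \<Longrightarrow> (u', v') \<in> D \<Longrightarrow> (u, v) \<noteq> (u', v') \<Longrightarrow> v \<le> u' \<or> v' \<le> u"
proof -
  show "finite D" "(u, v) \<in> D \<Longrightarrow> a \<le> u" "(u, v) \<in> D \<Longrightarrow> u < v" "(u, v) \<in> D \<Longrightarrow> v \<le> b"
    using assms unfolding interval_family_def by auto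
  assume D: "(u, v) \<in> D" "(u', v') \<in> D" "(u, v) \<noteq> (u', v')"
  have lt: "u < v" "u' < v'" using assms D unfolding interval_family_def by auto
  have "{u<..<v} \<inter> {u'<..<v'} = {}"
    using assms D unfolding interval_family_def disjoint_family_on_def by fastforce
  then have "(max u u' + min v v') / 2 \<notin> {u<..<v} \<inter> {u'<..<v'}" by simp
  then show "v \<le> u' \<or> v' \<le> u" using lt by (auto simp: max_def min_def split: if_splits)
qed

lemma interval_familyI:
  assumes "finite D"
    "\<And>u v. (u, v) \<in> D \<Longrightarrow> a \<le> u \<and> u < v \<and> v \<le> b"
    "\<And>u v u' v'. (u, v) \<in> D \<Longrightarrow> (u', v') \<in> D \<Longrightarrow> (u, v) \<noteq> (u', v') \<Longrightarrow> v \<le> u' \<or> v' \<le> u"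
  shows "interval_family a b D"
  unfolding interval_family_def disjoint_family_on_def using assms by fastforce

lemma interval_family_single: "a \<le> u \<Longrightarrow> u < v \<Longrightarrow> v \<le> b \<Longrightarrow> interval_family a b {(u, v)}"
  by (rule interval_familyI) auto

lemma interval_family_mono:
  "interval_family a b D \<Longrightarrow> a' \<le> a \<Longrightarrow> b \<le> b' \<Longrightarrow> interval_family a' b' D"
  unfolding interval_family_def by fastforce

lemma family_length_eq_measure:
  assumes "interval_family a b D"
  shows "family_incr (\<lambda>x. x) D = measure lborel (\<Union>(u, v)\<in>D. {u<..<v})"
proof -
  note D = interval_familyD[OF assms(1)]
  have "family_incr (\<lambda>x. x) D = (\<Sum>p\<in>D. measure lborel (case p of (u, v) \<Rightarrow> {u<..<v}))"
    unfolding family_incr_def using D by (intro sum.cong) (auto simp: less_imp_le)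
  also have "\<dots> = measure lborel (\<Union>p\<in>D. case p of (u, v) \<Rightarrow> {u<..<v})"
    using assms(1) unfolding interval_family_def
    by (intro measure_finite_Union[symmetric]) (auto split: prod.splits)
  finally show ?thesis .
qed

lemma family_length_le:
  assumes "interval_family a b D" "a \<le> b"
  shows "family_incr (\<lambda>x. x) D \<le> b - a"
proof -
  note D = interval_familyD[OF assms(1)]
  have "measure lborel (\<Union>(u, v)\<in>D. {u<..<v}) \<le> measure lborel {a..b}"
  proof (rule measure_mono_fmeasurable)
    show "(\<Union>p\<in>D. case p of (u, v) \<Rightarrow> {u<..<v}) \<subseteq> {a..b}"
      using D(2,4) by fastforce
    show "(\<Union>p\<in>D. case p of (u, v) \<Rightarrow> {u<..<v}) \<in> sets lborel"
      using D(1) by (intro sets.finite_UN) (auto split: prod.splits)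
    show "{a..b} \<in> fmeasurable lborel" using assms(2) by (intro fmeasurableI) auto
  qed
  then show ?thesis using assms(2) family_length_eq_measure[OF assms(1)] by simp
qed

text \<open>
  Cutting a family at \<open>b\<close> replaces an interval that straddles \<open>b\<close> by two intervals whose increases
  add up to the old one. Because increases are signed, this is an equality. It makes the positive variation below additive over adjacent intervals.
\<close>

lemma family_split:
  assumes "interval_family a c D" "a \<le> b" "b \<le> c"
  obtains D1 D2 where "interval_family a b D1" "interval_family b c D2"
    "family_incr F D = family_incr F D1 + family_incr F D2"
proof -
  note D = interval_familyD[OF assms(1)]
  let ?L = "{p \<in> D. fst p < b}" let ?R = "{p \<in> D. b < snd p}"
  let ?l = "\<lambda>p. (fst p, min (snd p) b)" let ?r = "\<lambda>p. (max (fst p) b, snd p)"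
  have lt: "fst p < snd p" if "p \<in> D" for p using D(3)[of "fst p" "snd p"] that by simp
  have inj: "inj_on ?l ?L" "inj_on ?r ?R"
    using D(3,5) by (fastforce simp: inj_on_def min_def max_def split: if_splits)+
  have 1: "interval_family a b (?l ` ?L)"
    by (rule interval_familyI) (use D assms in \<open>fastforce simp: min_def split: if_splits\<close>)+
  have 2: "interval_family b c (?r ` ?R)"
    by (rule interval_familyI) (use D assms in \<open>fastforce simp: max_def split: if_splits\<close>)+
  have "family_incr F D = (\<Sum>p\<in>D. (F (min (snd p) b) - F (min (fst p) b)) +
      (F (max (snd p) b) - F (max (fst p) b)))"
    unfolding family_incr_def by (intro sum.cong) (auto simp: min_def max_def)
  also have "\<dots> = (\<Sum>p\<in>D. F (min (snd p) b) - F (min (fst p) b)) +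
      (\<Sum>p\<in>D. F (max (snd p) b) - F (max (fst p) b))" by (rule sum.distrib)
  also have "(\<Sum>p\<in>D. F (min (snd p) b) - F (min (fst p) b)) =
      (\<Sum>p\<in>?L. F (min (snd p) b) - F (fst p))"
    using D(1) by (intro sum.mono_neutral_cong_right) (auto simp: min_def order.order_iff_strict dest: lt)
  also have "\<dots> = family_incr F (?l ` ?L)"
    unfolding family_incr_def by (subst sum.reindex[OF inj(1)]) simp
  also have "(\<Sum>p\<in>D. F (max (snd p) b) - F (max (fst p) b)) =
      (\<Sum>p\<in>?R. F (snd p) - F (max (fst p) b))"
    using D(1) by (intro sum.mono_neutral_cong_right) (auto simp: max_def order.order_iff_strict dest: lt)
  also have "\<dots> = family_incr F (?r ` ?R)"
    unfolding family_incr_def by (subst sum.reindex[OF inj(2)]) simp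
  finally show ?thesis using that 1 2 by blast
qed

text \<open>
  Absolute continuity with \<open>\<epsilon> = 1\<close> bounds the increase over every stretch shorter than \<open>\<delta>\<close> by
  \<open>1\<close>; finitely many such stretches cover \<open>[a, b]\<close>.
\<close>

lemma family_incr_bounded:
  fixes F :: "real \<Rightarrow> real"
  assumes ac: "abs_continuous_on a b (\<lambda>x. of_real (F x))" and "a \<le> b"
  shows "\<exists>B. \<forall>D. interval_family a b D \<longrightarrow> family_incr F D \<le> B"
proof -
  obtain \<delta> where \<delta>: "\<delta> > 0" "\<And>D. interval_family a b D \<Longrightarrow> family_incr (\<lambda>x. x) D < \<delta> \<Longrightarrow>
      (\<Sum>(u, v)\<in>D. norm (of_real (F v) - of_real (F u) :: complex)) < 1"
    using ac unfolding abs_continuous_on_alt by (meson zero_less_one)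
  have loc: "family_incr F D \<le> 1" if "interval_family x y D" "a \<le> x" "x \<le> y" "y \<le> b" "y - x < \<delta>" for x y D
  proof -
    have "family_incr F D \<le> (\<Sum>(u, v)\<in>D. norm (of_real (F v) - of_real (F u) :: complex))"
      unfolding family_incr_def by (intro sum_mono) (auto simp flip: of_real_diff)
    also have "\<dots> < 1"
      using family_length_le[OF that(1,3)] that by (intro \<delta>(2)) (auto intro: interval_family_mono)
    finally show ?thesis by simp
  qed
  have "\<exists>B. \<forall>D. interval_family a x D \<longrightarrow> family_incr F D \<le> B"
    if "a \<le> x" "x \<le> b" "x \<le> a + real n * (\<delta> / 2)" for n x
    using that
  proof (induction n arbitrary: x)
    case 0
    then show ?case using loc[of a x] \<delta>(1) by fastforce
  next
    case (Suc n)
    (* Peel off a stretch of length at most \<delta>/2 at the right end. *)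
    define y where "y = max a (x - \<delta> / 2)"
    have y: "a \<le> y" "y \<le> x" "x - y < \<delta>" "y \<le> b" "y \<le> a + real n * (\<delta> / 2)"
      using Suc.prems \<delta>(1) unfolding y_def by (auto simp: field_simps max_def)
    obtain B where B: "\<And>D. interval_family a y D \<Longrightarrow> family_incr F D \<le> B"
      using Suc.IH y by blast
    have "family_incr F D \<le> B + 1" if D: "interval_family a x D" for D
      by (rule family_split[OF D y(1,2), of F]) (use B loc[of y x] y Suc.prems in fastforce)
    then show ?case by blast
  qed
  moreover obtain n where "(b - a) / (\<delta> / 2) \<le> real n" using real_arch_simple by blast
  then have "b \<le> a + real n * (\<delta> / 2)" using \<delta>(1) by (simp add: field_simps)
  ultimately show ?thesis using \<open>a \<le> b\<close> by blast
qed

section \<open>Positive variation of an absolutely continuous function\<close>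

text \<open>
  The supremum of signed increases is the positive variation: the best family skips every interval
  on which \<open>F\<close> decreases, and the empty family contributes \<open>0\<close>. It splits \<open>F\<close> into a difference of
  two increasing functions, as in the Jordan decomposition.
\<close>

definition positive_variation :: "(real \<Rightarrow> real) \<Rightarrow> real \<Rightarrow> real \<Rightarrow> real" where
  "positive_variation F a x = Sup (family_incr F ` {D. interval_family a x D})"

lemma
  fixes F :: "real \<Rightarrow> real"
  assumes ac: "abs_continuous_on a b (\<lambda>x. of_real (F x))"
    and xy: "a \<le> x" "x \<le> y" "y \<le> b"
  shows positive_variation_mono: "positive_variation F a x \<le> positive_variation F a y"
    and positive_variation_incr: "F y - F x \<le> positive_variation F a y - positive_variation F a x"
    and positive_variation_approx: "\<epsilon> > 0 \<Longrightarrow> \<exists>D. interval_family x y D \<and>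
      positive_variation F a y - positive_variation F a x < family_incr F D + \<epsilon>"
proof -
  obtain B where B: "\<And>D. interval_family a b D \<Longrightarrow> family_incr F D \<le> B"
    using family_incr_bounded[OF ac] xy by force
  have emp: "interval_family c d {}" for c d by (rule interval_familyI) auto
  have bdd: "bdd_above (family_incr F ` {D. interval_family a z D})" if "z \<le> b" for z
    using B interval_family_mono[OF _ order_refl that] by (auto intro!: bdd_aboveI2)
  have up: "family_incr F D \<le> positive_variation F a z" if "interval_family a z D" "z \<le> b" for z D
    unfolding positive_variation_def using that bdd by (intro cSUP_upper) auto
  have ex: "\<exists>D. interval_family a z D \<and> positive_variation F a z < family_incr F D + \<epsilon>" if "\<epsilon> > 0" "z \<le> b" for z \<epsilon>
  proof -
    have "positive_variation F a z - \<epsilon> < Sup (family_incr F ` {D. interval_family a z D})"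
      using that unfolding positive_variation_def by simp
    then show ?thesis
      using emp by (subst (asm) less_cSUP_iff) (auto simp: bdd that algebra_simps)
  qed
  show "positive_variation F a x \<le> positive_variation F a y"
    unfolding positive_variation_def using emp interval_family_mono[OF _ order_refl xy(2)]
    by (intro cSUP_subset_mono bdd xy) auto
  show "F y - F x \<le> positive_variation F a y - positive_variation F a x"
  proof (cases "x = y")
    case False
    have "positive_variation F a x + (F y - F x) \<le> positive_variation F a y + \<epsilon>" if pos: "\<epsilon> > 0" for \<epsilon>
    proof -
      obtain D where D: "interval_family a x D" "positive_variation F a x < family_incr F D + \<epsilon>"
        using ex[OF pos, of x] xy by auto
      note DD = interval_familyD[OF D(1)]
      have ni: "(x, y) \<notin> D" using DD(4)[of x y] False xy by auto
      have "interval_family a y (insert (x, y) D)"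
        by (rule interval_familyI) (use DD xy False in \<open>fastforce\<close>)+
      from up[OF this] have "family_incr F D + (F y - F x) \<le> positive_variation F a y"
        using xy ni DD(1) by (simp add: family_incr_def)
      then show ?thesis using D(2) by simp
    qed
    then show ?thesis using field_le_epsilon by (smt (verit))
  qed simp
  show "\<exists>D. interval_family x y D \<and>
      positive_variation F a y - positive_variation F a x < family_incr F D + \<epsilon>" if "\<epsilon> > 0"
  proof -
    obtain D where D: "interval_family a y D" "positive_variation F a y < family_incr F D + \<epsilon>"
      using ex[OF \<open>\<epsilon> > 0\<close>, of y] xy by auto
    from family_split[OF D(1) xy(1,2), of F] obtain D1 D2 where
      "interval_family a x D1" "interval_family x y D2"
      "family_incr F D = family_incr F D1 + family_incr F D2" by metis
    then show ?thesis using D(2) up[of x D1] xy by (intro exI[of _ D2]) auto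
  qed
qed

text \<open>
  Refining every member of a family by a subfamily keeps it a family; this transports the smallness
  condition from \<open>F\<close> to its positive variation.
\<close>

lemma family_refine:
  assumes E: "interval_family a b E"
    and D: "\<And>u v. (u, v) \<in> E \<Longrightarrow> interval_family u v (D (u, v))"
  shows "interval_family a b (\<Union>p\<in>E. D p)"
    and "family_incr F (\<Union>p\<in>E. D p) = (\<Sum>p\<in>E. family_incr F (D p))"
proof -
  note E' = interval_familyD[OF E]
  note D' = interval_familyD[OF D]
  show "interval_family a b (\<Union>p\<in>E. D p)"
  proof (rule interval_familyI)
    show "finite (\<Union>p\<in>E. D p)" using E'(1) D'(1) by auto
    show "a \<le> u \<and> u < v \<and> v \<le> b" if uv: "(u, v) \<in> (\<Union>p\<in>E. D p)" for u v
    proof -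
      obtain c d where "(c, d) \<in> E" "(u, v) \<in> D (c, d)" using uv by auto
      then show ?thesis using E'(2-4)[of c d] D'(2-4)[of c d u v] by auto
    qed
    show "v \<le> u' \<or> v' \<le> u"
      if uv: "(u, v) \<in> (\<Union>p\<in>E. D p)" "(u', v') \<in> (\<Union>p\<in>E. D p)" "(u, v) \<noteq> (u', v')" for u v u' v'
    proof -
      obtain c d where 1: "(c, d) \<in> E" "(u, v) \<in> D (c, d)" using uv by auto
      obtain c' d' where 2: "(c', d') \<in> E" "(u', v') \<in> D (c', d')" using uv by auto
      show ?thesis
      proof (cases "(c, d) = (c', d')")
        case True
        then show ?thesis using D'(5)[OF 1] 2 uv(3) by auto
      next
        case False
        then show ?thesis using E'(5)[OF 1(1) 2(1)] D'(2-4)[OF 1] D'(2-4)[OF 2] by auto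
      qed
    qed
  qed
  have "D p \<inter> D q = {}" if "p \<in> E" "q \<in> E" "p \<noteq> q" for p q
  proof -
    have False if "(u, v) \<in> D p" "(u, v) \<in> D q" for u v
      using E'(5)[of "fst p" "snd p" "fst q" "snd q"] D'(2-4)[of "fst p" "snd p" u v]
        D'(2-4)[of "fst q" "snd q" u v] that \<open>p \<in> E\<close> \<open>q \<in> E\<close> \<open>p \<noteq> q\<close>
      by (auto simp: prod_eq_iff)
    then show ?thesis by auto
  qed
  then show "family_incr F (\<Union>p\<in>E. D p) = (\<Sum>p\<in>E. family_incr F (D p))"
    unfolding family_incr_def using E'(1) D'(1) by (intro sum.UNION_disjoint) auto
qed

lemma positive_variation_abs_continuous:
  fixes F :: "real \<Rightarrow> real"
  assumes ac: "abs_continuous_on a b (\<lambda>x. of_real (F x))"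
  shows "abs_continuous_on a b (\<lambda>x. of_real (positive_variation F a x))"
  unfolding abs_continuous_on_alt
proof (intro allI impI)
  fix \<epsilon> :: real assume "\<epsilon> > 0"
  then have "\<epsilon> / 2 > 0" by simp
  then obtain \<delta> where \<delta>: "\<delta> > 0" "\<And>D. interval_family a b D \<Longrightarrow> family_incr (\<lambda>x. x) D < \<delta> \<Longrightarrow>
      (\<Sum>(u, v)\<in>D. norm (of_real (F v) - of_real (F u) :: complex)) < \<epsilon> / 2"
    using ac unfolding abs_continuous_on_alt by meson
  let ?P = "positive_variation F a"
  show "\<exists>\<delta>>0. \<forall>D. interval_family a b D \<longrightarrow> family_incr (\<lambda>x. x) D < \<delta> \<longrightarrow>
      (\<Sum>(u, v)\<in>D. norm (of_real (?P v) - of_real (?P u) :: complex)) < \<epsilon>"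
  proof (intro exI[of _ \<delta>] conjI allI impI \<delta>(1))
    fix E assume E: "interval_family a b E" "family_incr (\<lambda>x. x) E < \<delta>"
    note E' = interval_familyD[OF E(1)]
    (* Each positive variation is only a supremum; this error per member adds up to less than \<epsilon>/2. *)
    define \<eta> where "\<eta> = \<epsilon> / (2 * (real (card E) + 1))"
    have \<eta>: "\<eta> > 0" "real (card E) * \<eta> < \<epsilon> / 2"
      unfolding \<eta>_def using \<open>\<epsilon> > 0\<close> by (auto simp: field_simps add_pos_nonneg)
    have "\<exists>D. interval_family (fst p) (snd p) D \<and> ?P (snd p) - ?P (fst p) < family_incr F D + \<eta>" if "p \<in> E" for p
      using positive_variation_approx[OF ac _ _ _ \<eta>(1), of "fst p" "snd p"] E'(2-4)[of "fst p" "snd p"] that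
      by (auto simp: less_imp_le)
    then obtain D where D: "\<And>p. p \<in> E \<Longrightarrow> interval_family (fst p) (snd p) (D p)"
        "\<And>p. p \<in> E \<Longrightarrow> ?P (snd p) - ?P (fst p) < family_incr F (D p) + \<eta>" by metis
    have D1: "interval_family u v (D (u, v))" if "(u, v) \<in> E" for u v using D(1)[OF that] by simp
    have ref: "interval_family a b (\<Union>p\<in>E. D p)"
      "family_incr G (\<Union>p\<in>E. D p) = (\<Sum>p\<in>E. family_incr G (D p))" for G
      using family_refine[OF E(1), of D] D1 by auto
    have "family_incr (\<lambda>x. x) (\<Union>p\<in>E. D p) \<le> (\<Sum>p\<in>E. snd p - fst p)"
      unfolding ref(2)
    proof (intro sum_mono family_length_le)
      fix p assume "p \<in> E"
      then show "interval_family (fst p) (snd p) (D p)" "fst p \<le> snd p"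
        using D(1) E'(3)[of "fst p" "snd p"] by auto
    qed
    also have "\<dots> = family_incr (\<lambda>x. x) E"
      unfolding family_incr_def by (intro sum.cong) auto
    finally have "family_incr (\<lambda>x. x) (\<Union>p\<in>E. D p) < \<delta>" using E(2) by simp
    from \<delta>(2)[OF ref(1) this]
    have lt: "(\<Sum>(u, v)\<in>(\<Union>p\<in>E. D p). norm (of_real (F v) - of_real (F u) :: complex)) < \<epsilon> / 2" .
    have "(\<Sum>(u, v)\<in>E. norm (of_real (?P v) - of_real (?P u) :: complex)) = (\<Sum>p\<in>E. ?P (snd p) - ?P (fst p))"
      using positive_variation_mono[OF ac] E'(2-4)
      by (intro sum.cong) (auto simp flip: of_real_diff simp: less_imp_le)
    also have "\<dots> \<le> (\<Sum>p\<in>E. family_incr F (D p) + \<eta>)"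
      using D(2) by (intro sum_mono less_imp_le)
    also have "\<dots> = family_incr F (\<Union>p\<in>E. D p) + real (card E) * \<eta>"
      by (simp add: ref(2) sum.distrib)
    also have "family_incr F (\<Union>p\<in>E. D p) \<le>
        (\<Sum>(u, v)\<in>(\<Union>p\<in>E. D p). norm (of_real (F v) - of_real (F u) :: complex))"
      unfolding family_incr_def by (intro sum_mono) (auto simp flip: of_real_diff)
    finally show "(\<Sum>(u, v)\<in>E. norm (of_real (?P v) - of_real (?P u) :: complex)) < \<epsilon>"
      using lt \<eta>(2) by simp
  qed
qed

section \<open>Calculus of absolutely continuous functions\<close>

text \<open>
  Closure of absolute continuity under every operation needed below (differences, products with
  bounded factors, real and imaginary parts, Lipschitz maps) is an instance of this comparison.
\<close>

lemma abs_continuous_on_dominated: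
  assumes f: "abs_continuous_on a b f" and g: "abs_continuous_on a b g" and C: "C \<ge> 0"
    and le: "\<And>u v. a \<le> u \<Longrightarrow> u < v \<Longrightarrow> v \<le> b \<Longrightarrow>
      norm (h v - h u) \<le> C * (norm (f v - f u) + norm (g v - g u))"
  shows "abs_continuous_on a b h"
  unfolding abs_continuous_on_alt
proof (intro allI impI)
  fix \<epsilon> :: real assume "\<epsilon> > 0"
  define e where "e = \<epsilon> / (C + 1) / 2"
  have "e + e = \<epsilon> / (C + 1)" unfolding e_def by (rule field_sum_of_halves)
  moreover have "C * (\<epsilon> / (C + 1)) < \<epsilon>" using \<open>\<epsilon> > 0\<close> C by (simp add: field_simps)
  ultimately have e: "e > 0" "C * (e + e) < \<epsilon>"
    using \<open>\<epsilon> > 0\<close> C unfolding e_def by simp_all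
  obtain d1 where d1: "d1 > 0" "\<And>D. interval_family a b D \<Longrightarrow> family_incr (\<lambda>x. x) D < d1 \<Longrightarrow>
      (\<Sum>(u, v)\<in>D. norm (f v - f u)) < e"
    using f e(1) unfolding abs_continuous_on_alt by meson
  obtain d2 where d2: "d2 > 0" "\<And>D. interval_family a b D \<Longrightarrow> family_incr (\<lambda>x. x) D < d2 \<Longrightarrow>
      (\<Sum>(u, v)\<in>D. norm (g v - g u)) < e"
    using g e(1) unfolding abs_continuous_on_alt by meson
  show "\<exists>\<delta>>0. \<forall>D. interval_family a b D \<longrightarrow> family_incr (\<lambda>x. x) D < \<delta> \<longrightarrow>
      (\<Sum>(u, v)\<in>D. norm (h v - h u)) < \<epsilon>"
  proof (intro exI[of _ "min d1 d2"] conjI allI impI)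
    fix D assume D: "interval_family a b D" "family_incr (\<lambda>x. x) D < min d1 d2"
    have "(\<Sum>(u, v)\<in>D. norm (h v - h u)) \<le>
        (\<Sum>p\<in>D. C * ((case p of (u, v) \<Rightarrow> norm (f v - f u)) + (case p of (u, v) \<Rightarrow> norm (g v - g u))))"
      using interval_familyD(2-4)[OF D(1)] le by (intro sum_mono) auto
    also have "\<dots> = C * ((\<Sum>(u, v)\<in>D. norm (f v - f u)) + (\<Sum>(u, v)\<in>D. norm (g v - g u)))"
      by (simp only: sum.distrib[symmetric] sum_distrib_left)
    also have "\<dots> \<le> C * (e + e)"
      using d1(2)[OF D(1)] d2(2)[OF D(1)] D(2) C by (intro mult_left_mono add_mono) auto
    finally show "(\<Sum>(u, v)\<in>D. norm (h v - h u)) < \<epsilon>" using e(2) by simp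
  qed (use d1(1) d2(1) in auto)
qed

lemma abs_continuous_on_id: "abs_continuous_on a b of_real"
  unfolding abs_continuous_on_alt
proof (intro allI impI)
  fix \<epsilon> :: real assume "\<epsilon> > 0"
  have "(\<Sum>(u, v)\<in>D. norm (of_real v - of_real u :: complex)) = family_incr (\<lambda>x. x) D"
    if "interval_family a b D" for D
    using interval_familyD(3)[OF that] unfolding family_incr_def
    by (intro sum.cong) (auto simp flip: of_real_diff simp: less_imp_le)
  with \<open>\<epsilon> > 0\<close> show "\<exists>\<delta>>0. \<forall>D. interval_family a b D \<longrightarrow> family_incr (\<lambda>x. x) D < \<delta> \<longrightarrow>
      (\<Sum>(u, v)\<in>D. norm (of_real v - of_real u :: complex)) < \<epsilon>" by auto
qed

lemma abs_continuous_on_lipschitz: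
  assumes "C \<ge> 0" "\<And>u v. a \<le> u \<Longrightarrow> u < v \<Longrightarrow> v \<le> b \<Longrightarrow> norm (f v - f u) \<le> C * (v - u)"
  shows "abs_continuous_on a b f"
proof (rule abs_continuous_on_dominated[OF abs_continuous_on_id abs_continuous_on_id assms(1)])
  fix u v :: real assume uv: "a \<le> u" "u < v" "v \<le> b"
  then have "norm (f v - f u) \<le> C * (v - u)" by (rule assms(2))
  also have "\<dots> \<le> C * (norm (of_real v - of_real u :: complex) + norm (of_real v - of_real u :: complex))"
    using uv assms(1) by (intro mult_left_mono) (auto simp flip: of_real_diff)
  finally show "norm (f v - f u) \<le> \<dots>" .
qed

lemma abs_continuous_on_diff:
  assumes "abs_continuous_on a b f" "abs_continuous_on a b g"
  shows "abs_continuous_on a b (\<lambda>x. f x - g x)"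
proof (rule abs_continuous_on_dominated[OF assms, of 1])
  fix u v
  have "norm ((f v - f u) - (g v - g u)) \<le> norm (f v - f u) + norm (g v - g u)"
    by (rule norm_triangle_ineq4)
  then show "norm (f v - g v - (f u - g u)) \<le> 1 * (norm (f v - f u) + norm (g v - g u))"
    by (simp add: algebra_simps)
qed simp

lemma abs_continuous_on_imp_continuous:
  assumes "abs_continuous_on a b f"
  shows "continuous_on {a..b} f"
  unfolding continuous_on_iff
proof (intro ballI allI impI)
  fix x e :: real assume x: "x \<in> {a..b}" and "e > 0"
  obtain d where d: "d > 0" "\<And>D. interval_family a b D \<Longrightarrow> family_incr (\<lambda>x. x) D < d \<Longrightarrow>
      (\<Sum>(u, v)\<in>D. norm (f v - f u)) < e"
    using assms \<open>e > 0\<close> unfolding abs_continuous_on_alt by meson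
  have lt: "norm (f v - f u) < e" if "a \<le> u" "u < v" "v \<le> b" "v - u < d" for u v
    using d(2)[OF interval_family_single[OF that(1-3)]] that(4) by (simp add: family_incr_def)
  have "dist (f y) (f x) < e" if "y \<in> {a..b}" "dist y x < d" for y
    using lt[of x y] lt[of y x] that x \<open>e > 0\<close>
    by (cases x y rule: linorder_cases) (auto simp: dist_norm norm_minus_commute abs_if split: if_splits)
  then show "\<exists>d>0. \<forall>x'\<in>{a..b}. dist x' x < d \<longrightarrow> dist (f x') (f x) < e"
    using d(1) by blast
qed

lemma abs_continuous_on_mult:
  assumes f: "abs_continuous_on a b f" and g: "abs_continuous_on a b g"
  shows "abs_continuous_on a b (\<lambda>x. f x * g x)"
proof -
  obtain A where A: "\<And>x. x \<in> {a..b} \<Longrightarrow> norm (f x) \<le> A"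
    using compact_imp_bounded[OF compact_continuous_image[OF abs_continuous_on_imp_continuous[OF f]]]
    unfolding bounded_iff by (metis compact_Icc imageI)
  obtain B where B: "\<And>x. x \<in> {a..b} \<Longrightarrow> norm (g x) \<le> B"
    using compact_imp_bounded[OF compact_continuous_image[OF abs_continuous_on_imp_continuous[OF g]]]
    unfolding bounded_iff by (metis compact_Icc imageI)
  let ?C = "\<bar>A\<bar> + \<bar>B\<bar>"
  show ?thesis
  proof (rule abs_continuous_on_dominated[OF f g, of ?C])
    fix u v assume uv: "a \<le> u" "u < v" "v \<le> b"
    have "f v * g v - f u * g u = g v * (f v - f u) + f u * (g v - g u)" by (simp add: algebra_simps)
    also have "norm \<dots> \<le> norm (g v) * norm (f v - f u) + norm (f u) * norm (g v - g u)"
      by (metis norm_mult norm_triangle_ineq)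
    also have "\<dots> \<le> ?C * norm (f v - f u) + ?C * norm (g v - g u)"
      using A[of u] B[of v] uv by (intro add_mono mult_right_mono) auto
    finally show "norm (f v * g v - f u * g u) \<le> ?C * (norm (f v - f u) + norm (g v - g u))"
      by (simp add: algebra_simps)
  qed simp
qed

section \<open>The fundamental theorem for absolutely continuous functions\<close>

text \<open>
  Coverings of null sets come as sets of closed boxes with disjoint interiors, whereas absolute
  continuity is tested on families of endpoints.
\<close>

lemma interval_family_of_boxes:
  fixes \<D> :: "real set set"
  assumes fin: "finite \<D>" and K: "\<And>K. K \<in> \<D> \<Longrightarrow> \<exists>u v. K = {u..v} \<and> a \<le> u \<and> u < v \<and> v \<le> b"
    and disj: "pairwise (\<lambda>A B. interior A \<inter> interior B = {}) \<D>"
  obtains E where "interval_family a b E" "\<D> = (\<lambda>(u, v). {u..v}) ` E"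
    "inj_on (\<lambda>(u, v). {u..v}) E" "(\<Union>(u, v)\<in>E. {u<..<v}) \<subseteq> \<Union>\<D>"
proof -
  define E where "E = {(u, v). u < v \<and> {u..v} \<in> \<D>}"
  have img: "\<D> = (\<lambda>(u, v). {u..v}) ` E" unfolding E_def using K by (fastforce simp: image_iff)
  have inj: "inj_on (\<lambda>(u, v). {u..v}) E" unfolding E_def inj_on_def by auto
  have "finite E" using finite_imageD[OF _ inj] img fin by auto
  have "interval_family a b E"
  proof (rule interval_familyI[OF \<open>finite E\<close>])
    show "a \<le> u \<and> u < v \<and> v \<le> b" if "(u, v) \<in> E" for u v
      using K[of "{u..v}"] that unfolding E_def by auto
    show "v \<le> u' \<or> v' \<le> u" if E: "(u, v) \<in> E" "(u', v') \<in> E" "(u, v) \<noteq> (u', v')" for u v u' v'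
    proof -
      have "{u..v} \<noteq> {u'..v'}" using E unfolding E_def by auto
      then have "interior {u..v} \<inter> interior {u'..v'} = {}"
        using E unfolding E_def by (intro pairwiseD[OF disj]) auto
      then have "\<not> max u u' < min v v'"
        by (simp only: interior_atLeastAtMost_real Int_greaterThanLessThan greaterThanLessThan_empty_iff not_less)
      moreover have "u < v" "u' < v'" using E unfolding E_def by auto
      then have "max u u' < min v v'" if "u' < v" "u < v'" using that by simp
      ultimately show ?thesis by (meson not_le)
    qed
  qed
  moreover have "(\<Union>(u, v)\<in>E. {u<..<v}) \<subseteq> \<Union>\<D>"
  proof
    fix x assume "x \<in> (\<Union>(u, v)\<in>E. {u<..<v})"
    then obtain u v where "(u, v) \<in> E" "u < x" "x < v" by auto
    then have "x \<in> {u..v}" "{u..v} \<in> \<D>" unfolding E_def by auto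
    then show "x \<in> \<Union>\<D>" by blast
  qed
  ultimately show ?thesis by (rule that[OF _ img inj])
qed

text \<open>
  The Stieltjes measure of an increasing absolutely continuous function gives every Lebesgue null set
  \<open>S\<close> measure zero: \<open>S\<close> is covered by countably many non-overlapping intervals of small total length,
  over which the function increases by little. The function is extended by constants beyond \<open>[a, b]\<close>,
  so that the measure lives on \<open>[a, b]\<close>.
\<close>

lemma
  fixes P Q :: "real \<Rightarrow> real"
  assumes "a < b" and ac: "abs_continuous_on a b (\<lambda>x. of_real (P x))"
    and mono: "\<And>x y. a \<le> x \<Longrightarrow> x \<le> y \<Longrightarrow> y \<le> b \<Longrightarrow> P x \<le> P y"
  defines "Q \<equiv> \<lambda>x. P (max a (min b x))"
  shows interval_measure_clamp_Icc: "u \<le> v \<Longrightarrow> emeasure (interval_measure Q) {u..v} = ennreal (Q v - Q u)"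
    and interval_measure_clamp_ac: "absolutely_continuous lborel (interval_measure Q)"
proof -
  let ?\<nu> = "interval_measure Q"
  have Qmono: "Q x \<le> Q y" if "x \<le> y" for x y
    unfolding Q_def using that \<open>a < b\<close> by (intro mono) auto
  have Pcont: "continuous_on {a..b} P"
    using continuous_on_Re[OF abs_continuous_on_imp_continuous[OF ac]] by simp
  have Qcont: "continuous_on UNIV Q"
    unfolding Q_def using \<open>a < b\<close>
    by (intro continuous_on_compose2[OF Pcont] continuous_intros) auto
  show Icc: "emeasure ?\<nu> {u..v} = ennreal (Q v - Q u)" if "u \<le> v" for u v
    using emeasure_interval_measure_Icc[OF that Qmono Qcont] .
  (* The countable cover is estimated through its finite subfamilies, since absolute continuity
     speaks about finite families only. *)
  have small: "emeasure ?\<nu> (S \<inter> {a..b}) \<le> ennreal \<epsilon>" if S: "S \<in> null_sets lborel" and "\<epsilon> > 0" for S \<epsilon>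
  proof -
    obtain \<delta> where \<delta>: "\<delta> > 0" "\<And>D. interval_family a b D \<Longrightarrow> family_incr (\<lambda>x. x) D < \<delta> \<Longrightarrow>
        (\<Sum>(u, v)\<in>D. norm (of_real (P v) - of_real (P u) :: complex)) < \<epsilon>"
      using ac \<open>\<epsilon> > 0\<close> unfolding abs_continuous_on_alt by meson
    have S': "S \<inter> cbox a b \<in> null_sets lborel" using S by (auto intro: null_set_Int2)
    then have Sl: "S \<inter> cbox a b \<in> null_sets lebesgue" by (rule null_sets_completionI)
    then have Sm: "S \<inter> cbox a b \<in> lmeasurable" by (auto intro: fmeasurableI_null_sets)
    obtain \<D> where \<D>: "countable \<D>"
        "\<And>K. K \<in> \<D> \<Longrightarrow> K \<subseteq> cbox a b \<and> K \<noteq> {} \<and> (\<exists>c d. K = cbox c d)"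
        "pairwise (\<lambda>A B. interior A \<inter> interior B = {}) \<D>"
        "\<And>u v. cbox u v \<in> \<D> \<Longrightarrow> \<exists>n. \<forall>i \<in> Basis. v \<bullet> i - u \<bullet> i = (b \<bullet> i - a \<bullet> i)/2^n"
        "\<And>K. \<lbrakk>K \<in> \<D>; box a b \<noteq> {}\<rbrakk> \<Longrightarrow> interior K \<noteq> {}"
        "S \<inter> cbox a b \<subseteq> \<Union>\<D>" "\<Union>\<D> \<in> lmeasurable"
        "measure lebesgue (\<Union>\<D>) \<le> measure lebesgue (S \<inter> cbox a b) + \<delta> / 2"
      by (rule measurable_outer_intervals_bounded[OF Sm Int_lower2 half_gt_zero[OF \<delta>(1)]]) (rule that; assumption)
    have K: "\<exists>u v. K = {u..v} \<and> a \<le> u \<and> u < v \<and> v \<le> b" if mem: "K \<in> \<D>" for K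
    proof -
      obtain c d where "K = cbox c d" using \<D>(2)[OF mem] by blast
      then show ?thesis using \<D>(2,5)[OF mem] \<open>a < b\<close>
        by (intro exI[of _ c] exI[of _ d]) (auto simp: interior_atLeastAtMost_real)
    qed
    have fm: "K \<in> fmeasurable ?\<nu>" if "K \<in> \<D>" for K
      using K[OF that] by (auto intro!: fmeasurableI simp: Icc)
    have bound: "measure ?\<nu> (\<Union>K\<in>\<D>'. K) \<le> \<epsilon>" if D': "\<D>' \<subseteq> \<D>" "finite \<D>'" for \<D>'
    proof -
      obtain E where E: "interval_family a b E" "\<D>' = (\<lambda>(u, v). {u..v}) ` E"
          "inj_on (\<lambda>(u, v). {u..v}) E" "(\<Union>(u, v)\<in>E. {u<..<v}) \<subseteq> \<Union>\<D>'"
        using interval_family_of_boxes[OF D'(2), of a b] K D'(1) pairwise_subset[OF \<D>(3) D'(1)] by (metis subsetD)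
      note E' = interval_familyD[OF E(1)]
      have "family_incr (\<lambda>x. x) E = measure lebesgue (\<Union>(u, v)\<in>E. {u<..<v})"
        unfolding family_length_eq_measure[OF E(1)]
        using E'(1) by (subst measure_completion) (auto split: prod.splits)
      also have "\<dots> \<le> measure lebesgue (\<Union>\<D>)"
      proof (rule measure_mono_fmeasurable[OF _ _ \<D>(7)])
        show "(\<Union>(u, v)\<in>E. {u<..<v}) \<subseteq> \<Union>\<D>" using E(4) D'(1) by blast
        show "(\<Union>(u, v)\<in>E. {u<..<v}) \<in> sets lebesgue" by (auto intro!: sets_completionI_sets borel_open open_UN)
      qed
      also have "\<dots> < \<delta>" using \<D>(8) Sl \<delta>(1) by (simp add: null_sets_def measure_def)
      finally have len: "family_incr (\<lambda>x. x) E < \<delta>" .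
      have "measure ?\<nu> (\<Union>K\<in>\<D>'. K) \<le> (\<Sum>K\<in>\<D>'. measure ?\<nu> K)"
        using K D' by (intro measure_UNION_le) fastforce+
      also have "\<dots> = (\<Sum>(u, v)\<in>E. measure ?\<nu> {u..v})"
        unfolding E(2) by (subst sum.reindex[OF E(3)]) (auto intro: sum.cong)
      also have "\<dots> = (\<Sum>(u, v)\<in>E. norm (of_real (P v) - of_real (P u) :: complex))"
      proof (intro sum.cong refl, clarify)
        fix u v assume "(u, v) \<in> E"
        then have uv: "a \<le> u" "u < v" "v \<le> b" using E' by auto
        then have "Q u = P u" "Q v = P v" "P u \<le> P v" unfolding Q_def using mono by auto
        then show "measure ?\<nu> {u..v} = norm (of_real (P v) - of_real (P u) :: complex)"
          using uv Icc[of u v] by (simp add: measure_def flip: of_real_diff)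
      qed
      also have "\<dots> < \<epsilon>" by (rule \<delta>(2)[OF E(1) len])
      finally show ?thesis by simp
    qed
    have meas: "\<Union>\<D> \<in> fmeasurable ?\<nu>" "measure ?\<nu> (\<Union>\<D>) \<le> \<epsilon>"
      using fmeasurable_UN_bound[OF \<D>(1), of "\<lambda>x. x"] measure_UN_bound[OF \<D>(1), of "\<lambda>x. x"] fm bound by auto
    have "emeasure ?\<nu> (\<Union>\<D>) = ennreal (measure ?\<nu> (\<Union>\<D>))"
      using meas(1) by (rule emeasure_eq_measure2)
    also have "\<dots> \<le> ennreal \<epsilon>" using meas(2) by (rule ennreal_leI)
    finally have le: "emeasure ?\<nu> (\<Union>\<D>) \<le> ennreal \<epsilon>" "\<Union>\<D> \<in> sets ?\<nu>"
      using meas(1) by (auto dest: fmeasurableD)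
    have "emeasure ?\<nu> (S \<inter> {a..b}) \<le> emeasure ?\<nu> (\<Union>\<D>)"
      using \<D>(6) le(2) by (intro emeasure_mono) auto
    with le(1) show ?thesis by simp
  qed
  show "absolutely_continuous lborel ?\<nu>"
    unfolding absolutely_continuous_def
  proof
    fix S :: "real set" assume S: "S \<in> null_sets lborel"
    have [measurable]: "S \<in> sets borel" using S by auto
    have "emeasure ?\<nu> (S \<inter> {a..b}) \<le> 0 + ennreal \<epsilon>" if "\<epsilon> > 0" for \<epsilon>
      using small[OF S that] by simp
    then have "emeasure ?\<nu> (S \<inter> {a..b}) \<le> 0" by (rule ennreal_le_epsilon)
    then have "emeasure ?\<nu> (S \<inter> {a..b}) = 0" by simp
    then have 1: "S \<inter> {a..b} \<in> null_sets ?\<nu>" by (rule null_setsI) simp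
    (* The constant extension puts no mass outside [a, b]. *)
    have "{u..v} \<in> null_sets ?\<nu>" if "u \<le> v" "Q u = Q v" for u v
      by (rule null_setsI) (simp_all add: Icc[OF that(1)] that(2))
    from this[of "a - real _" a] this[of b "b + real _"]
    have "{a - real n..a} \<in> null_sets ?\<nu>" "{b..b + real n} \<in> null_sets ?\<nu>" for n
      using \<open>a < b\<close> by (simp_all add: Q_def)
    then have 2: "(\<Union>n. {a - real n..a}) \<in> null_sets ?\<nu>" "(\<Union>n. {b..b + real n}) \<in> null_sets ?\<nu>"
      by (simp_all add: null_sets_UN)
    have "x \<in> (S \<inter> {a..b}) \<union> (\<Union>n. {a - real n..a}) \<union> (\<Union>n. {b..b + real n})" if "x \<in> S" for x
    proof -
      obtain n where "\<bar>x - a\<bar> + \<bar>x - b\<bar> \<le> real n" using real_arch_simple by blast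
      then show ?thesis using that by (cases "x < a"; cases "x > b") (auto intro!: exI[of _ n])
    qed
    then have "S \<subseteq> (S \<inter> {a..b}) \<union> (\<Union>n. {a - real n..a}) \<union> (\<Union>n. {b..b + real n})" by blast
    moreover have "(S \<inter> {a..b}) \<union> (\<Union>n. {a - real n..a}) \<union> (\<Union>n. {b..b + real n}) \<in> null_sets ?\<nu>"
      using 1 2 by (intro null_sets.Un)
    ultimately show "S \<in> null_sets ?\<nu>" by (rule null_sets_subset[rotated -1]) auto
  qed
qed

text \<open>
  The density is the Radon-Nikodym derivative of the Stieltjes measure with respect to Lebesgue
  measure.
\<close>

lemma mono_abs_continuous_indefinite_integral:
  fixes P :: "real \<Rightarrow> real"
  assumes "a < b" and ac: "abs_continuous_on a b (\<lambda>x. of_real (P x))"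
    and mono: "\<And>x y. a \<le> x \<Longrightarrow> x \<le> y \<Longrightarrow> y \<le> b \<Longrightarrow> P x \<le> P y"
  shows "\<exists>h. h absolutely_integrable_on {a..b} \<and>
    (\<forall>x\<in>{a..b}. (h has_integral (P x - P a)) {a..x})"
proof -
  define Q where "Q = (\<lambda>x. P (max a (min b x)))"
  let ?\<nu> = "interval_measure Q"
  note Icc = interval_measure_clamp_Icc[OF \<open>a < b\<close> ac mono, folded Q_def]
  have "absolutely_continuous lborel ?\<nu>"
    using interval_measure_clamp_ac[OF \<open>a < b\<close> ac mono, folded Q_def] by simp
  then obtain f where [measurable]: "f \<in> borel_measurable lborel" and f: "density lborel f = ?\<nu>"
    using sigma_finite_measure.Radon_Nikodym[OF sigma_finite_lborel, of ?\<nu>] by auto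
  have nn: "(\<integral>\<^sup>+y. f y * indicator {a..x} y \<partial>lborel) = ennreal (P x - P a)" if "x \<in> {a..b}" for x
  proof -
    have "(\<integral>\<^sup>+y. f y * indicator {a..x} y \<partial>lborel) = emeasure ?\<nu> {a..x}"
      unfolding f[symmetric] by (subst emeasure_density) auto
    also have "\<dots> = ennreal (P x - P a)" using that by (subst Icc) (auto simp: Q_def)
    finally show ?thesis .
  qed
  have "(\<integral>\<^sup>+y. f y * indicator {a..b} y \<partial>lborel) \<noteq> \<infinity>" using nn[of b] \<open>a < b\<close> by simp
  then have fin: "AE y in lborel. f y * indicator {a..b} y \<noteq> \<infinity>"
    by (intro nn_integral_noteq_infinite) auto
  define h where "h = (\<lambda>y. enn2real (f y))"
  have [measurable]: "h \<in> borel_measurable lborel" unfolding h_def by measurable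
  have hb: "has_bochner_integral lborel (\<lambda>y. indicator {a..x} y *\<^sub>R h y) (P x - P a)" if x: "x \<in> {a..b}" for x
  proof (rule has_bochner_integral_nn_integral)
    show "0 \<le> P x - P a" using mono[of a x] x by simp
    have "(\<integral>\<^sup>+y. ennreal (indicator {a..x} y *\<^sub>R h y) \<partial>lborel) = (\<integral>\<^sup>+y. f y * indicator {a..x} y \<partial>lborel)"
    proof (rule nn_integral_cong_AE, use fin in eventually_elim)
      fix y assume "f y * indicator {a..b} y \<noteq> \<infinity>"
      then show "ennreal (indicator {a..x} y *\<^sub>R h y) = f y * indicator {a..x} y"
        using x unfolding h_def by (auto simp: indicator_def less_top split: if_splits)
    qed
    then show "(\<integral>\<^sup>+y. ennreal (indicator {a..x} y *\<^sub>R h y) \<partial>lborel) = ennreal (P x - P a)"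
      using nn[OF x] by simp
  qed (auto simp: h_def)
  have si: "h absolutely_integrable_on {a..x}" "(LINT y:{a..x}|lebesgue. h y) = P x - P a"
    if "x \<in> {a..b}" for x
  proof -
    have m: "(\<lambda>y. indicator {a..x} y *\<^sub>R h y) \<in> borel_measurable lborel" by measurable
    show "h absolutely_integrable_on {a..x}" "(LINT y:{a..x}|lebesgue. h y) = P x - P a"
      unfolding set_integrable_def set_lebesgue_integral_def
      using hb[OF that] m by (simp_all add: integrable_completion integral_completion has_bochner_integral_iff)
  qed
  have "h absolutely_integrable_on {a..b}" using si(1)[of b] \<open>a < b\<close> by simp
  moreover have "(h has_integral (P x - P a)) {a..x}" if "x \<in> {a..b}" for x
    using has_integral_set_lebesgue[OF si(1)[OF that]] si(2)[OF that] by simp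
  ultimately show ?thesis by blast
qed

text \<open>
  Both the positive variation \<open>P\<close> and \<open>P - F\<close> are increasing and absolutely continuous, so the
  monotone case applies to each of them.
\<close>

lemma real_abs_continuous_indefinite_integral:
  fixes F :: "real \<Rightarrow> real"
  assumes "a < b" and ac: "abs_continuous_on a b (\<lambda>x. of_real (F x))"
  shows "\<exists>h. h absolutely_integrable_on {a..b} \<and>
    (\<forall>x\<in>{a..b}. (h has_integral (F x - F a)) {a..x})"
proof -
  let ?P = "positive_variation F a"
  have "\<exists>h. h absolutely_integrable_on {a..b} \<and> (\<forall>x\<in>{a..b}. (h has_integral (?P x - ?P a)) {a..x})"
    using positive_variation_mono[OF ac]
    by (intro mono_abs_continuous_indefinite_integral assms positive_variation_abs_continuous)
  then obtain h1 where h1: "h1 absolutely_integrable_on {a..b}"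
    "\<And>x. x \<in> {a..b} \<Longrightarrow> (h1 has_integral (?P x - ?P a)) {a..x}" by blast
  have "abs_continuous_on a b (\<lambda>x. of_real (?P x - F x))"
    using abs_continuous_on_diff[OF positive_variation_abs_continuous[OF ac] ac] by simp
  then have "\<exists>h. h absolutely_integrable_on {a..b} \<and>
      (\<forall>x\<in>{a..b}. (h has_integral ((?P x - F x) - (?P a - F a))) {a..x})"
  proof (rule mono_abs_continuous_indefinite_integral[OF \<open>a < b\<close>])
    show "?P x - F x \<le> ?P y - F y" if "a \<le> x" "x \<le> y" "y \<le> b" for x y
      using positive_variation_incr[OF ac that] by simp
  qed
  then obtain h2 where h2: "h2 absolutely_integrable_on {a..b}"
    "\<And>x. x \<in> {a..b} \<Longrightarrow> (h2 has_integral ((?P x - F x) - (?P a - F a))) {a..x}" by blast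
  show ?thesis
  proof (intro exI[of _ "\<lambda>x. h1 x - h2 x"] conjI ballI)
    show "(\<lambda>x. h1 x - h2 x) absolutely_integrable_on {a..b}"
      using h1(1) h2(1) by (rule set_integral_diff)
    show "((\<lambda>x. h1 x - h2 x) has_integral F x - F a) {a..x}" if "x \<in> {a..b}" for x
      using has_integral_diff[OF h1(2)[OF that] h2(2)[OF that]] by simp
  qed
qed

lemma abs_continuous_indefinite_integral:
  assumes "a < b" and ac: "abs_continuous_on a b F"
  shows "\<exists>h. h absolutely_integrable_on {a..b} \<and>
    (\<forall>x\<in>{a..b}. (h has_integral (F x - F a)) {a..x})"
proof -
  have le: "\<bar>Re z\<bar> \<le> 1 * (norm z + norm z)" "\<bar>Im z\<bar> \<le> 1 * (norm z + norm z)" for z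
    using abs_Re_le_cmod[of z] abs_Im_le_cmod[of z] norm_ge_zero[of z] by (simp_all del: norm_ge_zero)
  have "abs_continuous_on a b (\<lambda>x. of_real (Re (F x)))"
    by (rule abs_continuous_on_dominated[OF ac ac, of 1]) (use le(1)[of "F _ - F _"] in \<open>auto simp flip: of_real_diff\<close>)
  moreover have "abs_continuous_on a b (\<lambda>x. of_real (Im (F x)))"
    by (rule abs_continuous_on_dominated[OF ac ac, of 1]) (use le(2)[of "F _ - F _"] in \<open>auto simp flip: of_real_diff\<close>)
  ultimately have "abs_continuous_on a b (\<lambda>x. of_real (Re (F x)))" "abs_continuous_on a b (\<lambda>x. of_real (Im (F x)))" .
  from this[THEN real_abs_continuous_indefinite_integral[OF \<open>a < b\<close>]]
  obtain h1 h2 where h: "h1 absolutely_integrable_on {a..b}" "h2 absolutely_integrable_on {a..b}"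
    "\<And>x. x \<in> {a..b} \<Longrightarrow> (h1 has_integral (Re (F x) - Re (F a))) {a..x}"
    "\<And>x. x \<in> {a..b} \<Longrightarrow> (h2 has_integral (Im (F x) - Im (F a))) {a..x}" by blast
  show ?thesis
  proof (intro exI[of _ "\<lambda>x. of_real (h1 x) + \<i> * of_real (h2 x)"] conjI ballI)
    show "(\<lambda>x. of_real (h1 x) + \<i> * of_real (h2 x)) absolutely_integrable_on {a..b}"
      using h(1,2) by (intro set_integral_add set_integrable_mult_right)
        (auto intro: absolutely_integrable_linear[OF _ bounded_linear_of_real, unfolded o_def])
    show "((\<lambda>x. of_real (h1 x) + \<i> * of_real (h2 x)) has_integral F x - F a) {a..x}" if "x \<in> {a..b}" for x
    proof -
      have "((\<lambda>x. of_real (h1 x) + \<i> * of_real (h2 x)) has_integral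
          of_real (Re (F x) - Re (F a)) + \<i> * of_real (Im (F x) - Im (F a))) {a..x}"
        using h(3,4)[OF that] by (intro has_integral_add has_integral_mult_right has_integral_of_real)
      also have "of_real (Re (F x) - Re (F a)) + \<i> * of_real (Im (F x) - Im (F a)) = F x - F a"
        by (simp add: complex_eq_iff)
      finally show ?thesis .
    qed
  qed
qed


text \<open>
  The one-sided averages \<open>(1/t) \<integral> h\<close> over \<open>[x, x + t]\<close> tend to \<open>h x\<close> for almost every \<open>x\<close>. The same
  statement for the reflected function \<open>h (- x)\<close> gives the averages to the left of \<open>x\<close>.
\<close>

lemma indefinite_integral_has_derivative_ae:
  fixes h :: "real \<Rightarrow> complex"
  assumes h: "h absolutely_integrable_on {a..b}"
    and F: "\<And>x. x \<in> {a..b} \<Longrightarrow> (h has_integral (F x - F a)) {a..x}"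
  obtains N where "negligible N"
    "\<And>x. x \<in> {a<..<b} - N \<Longrightarrow> (F has_vector_derivative h x) (at x)"
proof -
  define H where "H = (\<lambda>x. if x \<in> {a..b} then h x else 0)"
  have HU: "H integrable_on UNIV"
    unfolding H_def using set_lebesgue_integral_eq_integral(1)[OF h] by (simp only: integrable_restrict_UNIV)
  have Hi: "H integrable_on cbox c d" for c d
    using HU integrable_on_subcbox by blast
  obtain N1 where N1: "negligible N1" "\<And>x e. \<lbrakk>x \<notin> N1; 0 < e\<rbrakk> \<Longrightarrow>
      \<exists>d>0. \<forall>t. 0 < t \<and> t < d \<longrightarrow> norm (integral (cbox x (x + t *\<^sub>R One)) H /\<^sub>R t ^ DIM(real) - H x) < e"
    using integrable_ccontinuous_explicit[OF Hi] by blast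
  have "(\<lambda>x. H (- x)) integrable_on cbox c d" for c d
    using Hi[of "-d" "-c"] Henstock_Kurzweil_Integration.integrable_reflect_real[where f = H and a = "-d" and b = "-c"] by simp
  then obtain N2 where N2: "negligible N2" "\<And>x e. \<lbrakk>x \<notin> N2; 0 < e\<rbrakk> \<Longrightarrow>
      \<exists>d>0. \<forall>t. 0 < t \<and> t < d \<longrightarrow>
        norm (integral (cbox x (x + t *\<^sub>R One)) (\<lambda>x. H (- x)) /\<^sub>R t ^ DIM(real) - H (- x)) < e"
    using integrable_ccontinuous_explicit[of "\<lambda>x. H (- x)"] by blast
  have "negligible (uminus ` N2)"
    using N2(1) by (intro negligible_differentiable_image_negligible) (auto intro: derivative_intros)
  with N1(1) have "negligible (N1 \<union> uminus ` N2)" by (rule negligible_Un)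
  moreover have "(F has_vector_derivative h x) (at x)" if x: "x \<in> {a<..<b} - (N1 \<union> uminus ` N2)" for x
  proof -
    have incr: "F v - F u = integral {u..v} H" if "a \<le> u" "u \<le> v" "v \<le> b" for u v
    proof -
      have "integral {a..u} h + integral {u..v} h = integral {a..v} h"
        using that has_integral_integrable[OF F[of v]] by (intro Henstock_Kurzweil_Integration.integral_combine) auto
      moreover have "integral {a..u} h = F u - F a" "integral {a..v} h = F v - F a"
        using F[of u] F[of v] that by auto
      moreover have "integral {u..v} H = integral {u..v} h"
        using that by (intro integral_cong) (auto simp: H_def)
      ultimately show ?thesis by (simp add: algebra_simps)
    qed
    have "x \<notin> N1" "- x \<notin> N2" using x by (auto simp: image_iff)
    have "H x = h x" using x by (simp add: H_def)
    show ?thesis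
      unfolding has_vector_derivative_def has_derivative_at_alt
    proof (intro conjI allI impI)
      show "bounded_linear (\<lambda>y. y *\<^sub>R h x)" by (rule bounded_linear_scaleR_left)
      fix e :: real assume "e > 0"
      obtain d1 where d1: "d1 > 0" "\<And>t. 0 < t \<Longrightarrow> t < d1 \<Longrightarrow> norm (integral {x..x+t} H /\<^sub>R t - h x) < e"
        using N1(2)[OF \<open>x \<notin> N1\<close> \<open>e > 0\<close>] \<open>H x = h x\<close> by auto
      obtain d2 where d2: "d2 > 0"
        "\<And>t. 0 < t \<Longrightarrow> t < d2 \<Longrightarrow> norm (integral {-x..-x+t} (\<lambda>x. H (- x)) /\<^sub>R t - h x) < e"
        using N2(2)[OF \<open>- x \<notin> N2\<close> \<open>e > 0\<close>] \<open>H x = h x\<close> by auto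
      have scale: "norm (I - t *\<^sub>R h x) \<le> e * t" if "norm (I /\<^sub>R t - h x) < e" "t > 0" for I t
      proof -
        have "I - t *\<^sub>R h x = t *\<^sub>R (I /\<^sub>R t - h x)" using that(2) by (simp add: scaleR_diff_right)
        then show ?thesis using that by (simp add: mult.commute)
      qed
      define d where "d = Min {d1, d2, x - a, b - x}"
      have d: "d > 0" "d \<le> d1" "d \<le> d2" "d \<le> x - a" "d \<le> b - x" using d1(1) d2(1) x by (auto simp: d_def)
      show "\<exists>d>0. \<forall>y. norm (y - x) < d \<longrightarrow> norm (F y - F x - (y - x) *\<^sub>R h x) \<le> e * norm (y - x)"
      proof (intro exI[of _ d] conjI allI impI d(1))
        fix y assume y: "norm (y - x) < d"
        consider "y = x" | "y > x" | "y < x" by linarith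
        then show "norm (F y - F x - (y - x) *\<^sub>R h x) \<le> e * norm (y - x)"
        proof cases
          case 2
          then show ?thesis
            using scale[OF d1(2)[of "y - x"]] y d x incr[of x y] by simp
        next
          case 3
          have "integral {-x..-x+(x-y)} (\<lambda>x. H (- x)) = integral {y..x} H"
            using Henstock_Kurzweil_Integration.integral_reflect_real[of x y H] by simp
          also have "\<dots> = F x - F y" using 3 y d x incr[of y x] by simp
          finally have "norm (F x - F y - (x - y) *\<^sub>R h x) \<le> e * (x - y)"
            using scale[OF d2(2)[of "x - y"]] y d 3 by simp
          moreover have "F y - F x - (y - x) *\<^sub>R h x = - (F x - F y - (x - y) *\<^sub>R h x)"
            by (simp add: algebra_simps)
          ultimately show ?thesis using 3 by (simp only: norm_minus_cancel) simp
        qed simp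
      qed
    qed
  qed
  ultimately show ?thesis using that by blast
qed

lemma abs_continuous_differentiable_ae:
  assumes "a < b" "abs_continuous_on a b F"
  shows "AE x in lebesgue. x \<in> {a..b} \<longrightarrow> F differentiable (at x within {a..b})"
proof -
  obtain h where h: "h absolutely_integrable_on {a..b}"
    "\<And>x. x \<in> {a..b} \<Longrightarrow> (h has_integral (F x - F a)) {a..x}"
    using abs_continuous_indefinite_integral[OF assms] by blast
  obtain N where N: "negligible N" "\<And>x. x \<in> {a<..<b} - N \<Longrightarrow> (F has_vector_derivative h x) (at x)"
    using indefinite_integral_has_derivative_ae[OF h] by metis
  have "negligible (N \<union> {a, b})" using N(1) by (simp add: negligible_Un)
  then have null: "N \<union> {a, b} \<in> null_sets lebesgue" by (simp add: negligible_iff_null_sets)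
  show ?thesis
  proof (rule AE_I'[OF null], intro subsetI, rule ccontr)
    fix x assume x: "x \<in> {x \<in> space lebesgue. \<not> (x \<in> {a..b} \<longrightarrow> F differentiable (at x within {a..b}))}"
      "x \<notin> N \<union> {a, b}"
    then have "(F has_vector_derivative h x) (at x within {a..b})"
      using N(2)[of x] by (auto intro: has_vector_derivative_at_within)
    with x(1) show False using differentiableI_vector by blast
  qed
qed

text \<open>
  The almost everywhere derivative agrees almost everywhere with the density found above, hence it
  is integrable and integrates back to \<open>F\<close>.
\<close>

theorem abs_continuous_fundamental_theorem:
  assumes "a < b" and F: "abs_continuous_on a b F"
    and D: "AE x in lebesgue. x \<in> {a..b} \<longrightarrow> (F has_vector_derivative D x) (at x within {a..b})"
  shows "D absolutely_integrable_on {a..b}"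
    and "x \<in> {a..b} \<Longrightarrow> (D has_integral (F x - F a)) {a..x}"
proof -
  obtain h where h: "h absolutely_integrable_on {a..b}"
    "\<And>x. x \<in> {a..b} \<Longrightarrow> (h has_integral (F x - F a)) {a..x}"
    using abs_continuous_indefinite_integral[OF assms(1,2)] by blast
  obtain N where N: "negligible N" "\<And>x. x \<in> {a<..<b} - N \<Longrightarrow> (F has_vector_derivative h x) (at x)"
    using indefinite_integral_has_derivative_ae[OF h] by metis
  obtain M where M: "M \<in> null_sets lebesgue"
    "\<And>x. x \<in> {a..b} - M \<Longrightarrow> (F has_vector_derivative D x) (at x within {a..b})"
    using D unfolding eventually_ae_filter by auto
  (* At the endpoints the one-sided derivative need not be the density, but they form a null set. *)
  have neg: "negligible (N \<union> M \<union> {a, b})"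
    using N(1) M(1)[folded negligible_iff_null_sets] by (simp add: negligible_Un)
  have eq: "D x = h x" if "x \<in> {a..b} - (N \<union> M \<union> {a, b})" for x
  proof (rule vector_derivative_unique_within)
    show "at x within {a..b} \<noteq> bot"
      using that \<open>a < b\<close> by (auto simp: trivial_limit_within islimpt_Icc)
    show "(F has_vector_derivative D x) (at x within {a..b})"
      using M(2) that by auto
    show "(F has_vector_derivative h x) (at x within {a..b})"
      using N(2)[of x] that by (auto intro: has_vector_derivative_at_within)
  qed
  show "D absolutely_integrable_on {a..b}"
    using absolutely_integrable_spike[OF h(1) neg eq] by blast
  show "(D has_integral (F x - F a)) {a..x}" if "x \<in> {a..b}"
    using has_integral_spike[OF neg _ h(2)[OF that]] eq that by auto
qed

section \<open>Continuously differentiable functions and integration by parts\<close>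

lemma abs_continuous_on_C1:
  assumes f: "\<And>x. x \<in> {a..b} \<Longrightarrow> (f has_vector_derivative f' x) (at x within {a..b})"
    and f': "continuous_on {a..b} f'"
  shows "abs_continuous_on a b f"
proof -
  obtain C where C: "\<And>x. x \<in> {a..b} \<Longrightarrow> norm (f' x) \<le> C"
    using compact_imp_bounded[OF compact_continuous_image[OF f']] unfolding bounded_iff by (metis compact_Icc imageI)
  show ?thesis
  proof (rule abs_continuous_on_lipschitz)
    show "\<bar>C\<bar> \<ge> 0" by simp
    fix u v assume uv: "a \<le> u" "u < v" "v \<le> b"
    have "norm (f v - f u) \<le> \<bar>C\<bar> * norm (v - u)"
    proof (rule differentiable_bound[of "{a..b}"])
      show "(f has_derivative (\<lambda>h. h *\<^sub>R f' x)) (at x within {a..b})" if "x \<in> {a..b}" for x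
        using f[OF that] unfolding has_vector_derivative_def .
      show "onorm (\<lambda>h. h *\<^sub>R f' x) \<le> \<bar>C\<bar>" if "x \<in> {a..b}" for x
      proof (rule onorm_le)
        fix h :: real
        have "\<bar>h\<bar> * cmod (f' x) \<le> \<bar>h\<bar> * \<bar>C\<bar>" using C[OF that] by (intro mult_left_mono) auto
        then show "norm (h *\<^sub>R f' x) \<le> \<bar>C\<bar> * norm h" by (simp add: mult.commute)
      qed
    qed (use uv in auto)
    then show "norm (f v - f u) \<le> \<bar>C\<bar> * (v - u)" using uv by simp
  qed
qed

text \<open>
  The product of \<open>F\<close> with a continuously differentiable function is again absolutely continuous, so
  this is the fundamental theorem applied to \<open>F \<phi>\<close>.
\<close>

lemma abs_continuous_integration_by_parts:
  fixes F :: "real \<Rightarrow> complex"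
  assumes "a < b" and F: "abs_continuous_on a b F"
    and D: "AE x in lebesgue. x \<in> {a..b} \<longrightarrow> (F has_vector_derivative D x) (at x within {a..b})"
    and \<phi>: "\<And>x. x \<in> {a..b} \<Longrightarrow> (\<phi> has_vector_derivative \<phi>' x) (at x within {a..b})"
    and \<phi>': "continuous_on {a..b} \<phi>'"
  shows "((\<lambda>x. D x * \<phi> x) has_integral (F b * \<phi> b - F a * \<phi> a - integral {a..b} (\<lambda>x. F x * \<phi>' x))) {a..b}"
proof -
  have "((\<lambda>x. D x * \<phi> x + F x * \<phi>' x) has_integral (F b * \<phi> b - F a * \<phi> a)) {a..b}"
  proof (rule abs_continuous_fundamental_theorem(2)[OF \<open>a < b\<close>])
    show "abs_continuous_on a b (\<lambda>x. F x * \<phi> x)"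
      by (rule abs_continuous_on_mult[OF F abs_continuous_on_C1[OF \<phi> \<phi>']])
    show "AE x in lebesgue. x \<in> {a..b} \<longrightarrow>
        ((\<lambda>x. F x * \<phi> x) has_vector_derivative (D x * \<phi> x + F x * \<phi>' x)) (at x within {a..b})"
      using D
    proof (eventually_elim, intro impI)
      fix x assume "x \<in> {a..b} \<longrightarrow> (F has_vector_derivative D x) (at x within {a..b})" and x: "x \<in> {a..b}"
      then have "(F has_vector_derivative D x) (at x within {a..b})" by simp
      from has_vector_derivative_mult[OF this \<phi>[OF x]]
      show "((\<lambda>x. F x * \<phi> x) has_vector_derivative (D x * \<phi> x + F x * \<phi>' x)) (at x within {a..b})"
        by (simp add: add.commute)
    qed
  qed (use \<open>a < b\<close> in auto)
  moreover have "((\<lambda>x. F x * \<phi>' x) has_integral integral {a..b} (\<lambda>x. F x * \<phi>' x)) {a..b}"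
    by (intro integrable_integral integrable_continuous_interval continuous_on_mult
        abs_continuous_on_imp_continuous[OF F] \<phi>')
  ultimately have "((\<lambda>x. (D x * \<phi> x + F x * \<phi>' x) - F x * \<phi>' x) has_integral
      (F b * \<phi> b - F a * \<phi> a - integral {a..b} (\<lambda>x. F x * \<phi>' x))) {a..b}"
    by (rule has_integral_diff)
  then show ?thesis by simp
qed

section \<open>Square integrable functions on the unit interval\<close>

definition square_integrable :: "(real \<Rightarrow> complex) \<Rightarrow> bool" where
  "square_integrable f \<longleftrightarrow> f \<in> borel_measurable (lebesgue_on {0..1}) \<and>
     (\<lambda>x. (cmod (f x))\<^sup>2) integrable_on {0..1}"

definition l2_energy :: "(real \<Rightarrow> complex) \<Rightarrow> real" where
  "l2_energy f = integral {0..1} (\<lambda>x. (cmod (f x))\<^sup>2)"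

lemma l2_energy_nonneg [simp]: "0 \<le> l2_energy f"
  unfolding l2_energy_def
  by (cases "(\<lambda>x. (cmod (f x))\<^sup>2) integrable_on {0..1}")
    (auto intro: Henstock_Kurzweil_Integration.integral_nonneg simp: not_integrable_integral)

lemma square_integrable_mult:
  assumes f: "square_integrable f" and g: "square_integrable g"
  shows "(\<lambda>x. f x * g x) absolutely_integrable_on {0..1}"
proof (rule measurable_bounded_by_integrable_imp_absolutely_integrable)
  show "(\<lambda>x. f x * g x) \<in> borel_measurable (lebesgue_on {0..1})"
    using f g unfolding square_integrable_def by (intro borel_measurable_times) auto
  show "(\<lambda>x. (cmod (f x))\<^sup>2 + (cmod (g x))\<^sup>2) integrable_on {0..1}"
    using f g unfolding square_integrable_def by (intro integrable_add) auto
  show "cmod (f x * g x) \<le> (cmod (f x))\<^sup>2 + (cmod (g x))\<^sup>2" for x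
  proof -
    have "0 \<le> cmod (f x) * cmod (g x)" by simp
    then show ?thesis using sum_squares_bound[of "cmod (f x)" "cmod (g x)"] unfolding norm_mult by linarith
  qed
qed auto

lemma square_integrable_continuous: "continuous_on {0..1} f \<Longrightarrow> square_integrable f"
  unfolding square_integrable_def
  by (intro conjI continuous_imp_measurable_on_sets_lebesgue integrable_continuous_interval continuous_intros) auto

lemma square_integrable_imp_absolutely_integrable:
  "square_integrable f \<Longrightarrow> f absolutely_integrable_on {0..1}"
  using square_integrable_mult[of f "\<lambda>_. 1"] square_integrable_continuous[of "\<lambda>_. 1"] by simp

text \<open>
  The quadratic form \<open>(s, t) \<mapsto> \<integral> (s |f| - t |g|)\<^sup>2\<close> is nonnegative; evaluating it at suitable
  \<open>(s, t)\<close> gives the discriminant inequality.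
\<close>

lemma l2_Cauchy_Schwarz:
  assumes f: "square_integrable f" and g: "square_integrable g"
  shows "(integral {0..1} (\<lambda>x. cmod (f x) * cmod (g x)))\<^sup>2 \<le> l2_energy f * l2_energy g"
proof -
  define A B C where "A = l2_energy f" and "B = l2_energy g"
    and "C = integral {0..1} (\<lambda>x. cmod (f x) * cmod (g x))"
  have intf: "((\<lambda>x. (cmod (f x))\<^sup>2) has_integral A) {0..1}" "((\<lambda>x. (cmod (g x))\<^sup>2) has_integral B) {0..1}"
    using f g unfolding A_def B_def l2_energy_def square_integrable_def by (auto intro: integrable_integral)
  have "(\<lambda>x. cmod (f x * g x)) integrable_on {0..1}"
    using square_integrable_mult[OF f g] by (simp add: absolutely_integrable_on_def)
  then have intfg: "((\<lambda>x. cmod (f x) * cmod (g x)) has_integral C) {0..1}"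
    unfolding C_def norm_mult by (rule integrable_integral)
  have AB: "A \<ge> 0" "B \<ge> 0" unfolding A_def B_def by auto
  have quad: "0 \<le> s\<^sup>2 * A - 2 * s * t * C + t\<^sup>2 * B" for s t
  proof -
    have "((\<lambda>x. s\<^sup>2 * (cmod (f x))\<^sup>2 - (2 * s * t) * (cmod (f x) * cmod (g x)) + t\<^sup>2 * (cmod (g x))\<^sup>2)
        has_integral (s\<^sup>2 * A - (2 * s * t) * C + t\<^sup>2 * B)) {0..1}"
      by (intro has_integral_add has_integral_diff has_integral_mult_right intf intfg)
    then show ?thesis
    proof (rule has_integral_nonneg)
      fix x
      have "0 \<le> (s * cmod (f x) - t * cmod (g x))\<^sup>2" by simp
      then show "0 \<le> s\<^sup>2 * (cmod (f x))\<^sup>2 - (2 * s * t) * (cmod (f x) * cmod (g x)) + t\<^sup>2 * (cmod (g x))\<^sup>2"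
        by (simp add: power2_diff power_mult_distrib algebra_simps)
    qed
  qed
  have "C\<^sup>2 \<le> A * B"
  proof (cases "B = 0")
    case True
    have "C = 0"
    proof (rule ccontr)
      assume "C \<noteq> 0"
      (* With B = 0 the form is linear in t, and t = (A + 1) / (2 C) makes it equal to -1. *)
      have "0 \<le> A - 2 * ((A + 1) / (2 * C)) * C" using quad[of 1 "(A + 1) / (2 * C)"] True by simp
      also have "\<dots> = - 1" using \<open>C \<noteq> 0\<close> by (simp add: field_simps)
      finally show False by simp
    qed
    then show ?thesis using True by simp
  next
    case False
    then have "B > 0" using AB by simp
    have "0 \<le> B\<^sup>2 * A - 2 * B * C * C + C\<^sup>2 * B" by (rule quad)
    also have "\<dots> = B * (A * B - C\<^sup>2)" by (simp add: power2_eq_square algebra_simps)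
    finally show ?thesis using \<open>B > 0\<close> by (simp add: zero_le_mult_iff)
  qed
  then show ?thesis unfolding A_def B_def C_def .
qed

lemma l2_Cauchy_Schwarz_product:
  assumes f: "square_integrable f" and g: "square_integrable g"
  shows "cmod (integral {0..1} (\<lambda>x. f x * g x)) \<le> sqrt (l2_energy f * l2_energy g)"
proof -
  have "cmod (integral {0..1} (\<lambda>x. f x * g x)) \<le> integral {0..1} (\<lambda>x. cmod (f x) * cmod (g x))"
    using square_integrable_mult[OF f g]
    by (intro Henstock_Kurzweil_Integration.integral_norm_bound_integral)
      (auto simp: absolutely_integrable_on_def norm_mult)
  also have "\<dots> \<le> sqrt (l2_energy f * l2_energy g)"
    using l2_Cauchy_Schwarz[OF f g] by (rule real_le_rsqrt)
  finally show ?thesis .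
qed

lemma l1_le_l2:
  assumes f: "square_integrable f"
  shows "integral {0..1} (\<lambda>x. cmod (f x)) \<le> sqrt (l2_energy f)"
proof -
  have "(integral {0..1} (\<lambda>x. cmod (f x)))\<^sup>2 \<le> l2_energy f"
    using l2_Cauchy_Schwarz[OF f square_integrable_continuous[of "\<lambda>_. 1"]] by (simp add: l2_energy_def)
  then show ?thesis by (rule real_le_rsqrt)
qed

text \<open>
  Subtracting the mean is the orthogonal projection onto the complement of the constants.
\<close>

lemma l2_energy_diff_mean:
  assumes f: "square_integrable f"
  shows "square_integrable (\<lambda>x. f x - integral {0..1} f)"
    and "l2_energy (\<lambda>x. f x - integral {0..1} f) = l2_energy f - (cmod (integral {0..1} f))\<^sup>2"
proof -
  let ?c = "integral {0..1} f"
  have expand: "(cmod (z - ?c))\<^sup>2 = (cmod z)\<^sup>2 - 2 * Re (z * cnj ?c) + (cmod ?c)\<^sup>2" for z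
    unfolding cmod_power2 by (simp add: power2_eq_square algebra_simps)
  have f2: "((\<lambda>x. (cmod (f x))\<^sup>2) has_integral l2_energy f) {0..1}"
    using f unfolding square_integrable_def l2_energy_def by (auto intro: integrable_integral)
  have "(f has_integral ?c) {0..1}"
    using set_lebesgue_integral_eq_integral(1)[OF square_integrable_imp_absolutely_integrable[OF f]]
    by (rule integrable_integral)
  then have "((\<lambda>x. f x * cnj ?c) has_integral ?c * cnj ?c) {0..1}" by (rule has_integral_mult_left)
  from has_integral_linear[OF this bounded_linear_Re]
  have "((\<lambda>x. Re (f x * cnj ?c)) has_integral (cmod ?c)\<^sup>2) {0..1}"
    by (simp add: o_def flip: complex_norm_square of_real_power)
  then have "((\<lambda>x. (cmod (f x))\<^sup>2 - 2 * Re (f x * cnj ?c) + (cmod ?c)\<^sup>2) has_integral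
      (l2_energy f - 2 * (cmod ?c)\<^sup>2 + (cmod ?c)\<^sup>2)) {0..1}"
    using has_integral_const_real[of "(cmod ?c)\<^sup>2" 0 1]
    by (intro has_integral_add has_integral_diff has_integral_mult_right f2) auto
  then have I: "((\<lambda>x. (cmod (f x - ?c))\<^sup>2) has_integral (l2_energy f - (cmod ?c)\<^sup>2)) {0..1}"
    unfolding expand by simp
  then show "square_integrable (\<lambda>x. f x - ?c)"
    using f unfolding square_integrable_def by (auto intro: borel_measurable_diff)
  show "l2_energy (\<lambda>x. f x - ?c) = l2_energy f - (cmod ?c)\<^sup>2"
    unfolding l2_energy_def using I[unfolded l2_energy_def] by (rule integral_unique)
qed

section \<open>Chains of derivatives and the unit ball of the Sobolev space\<close>

text \<open>
  Every member below the top is required only to be absolutely continuous with the next one as its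
  almost everywhere derivative. This uniform condition covers the derivatives of a function in \<open>H\<^sup>s\<close>, although those below
  order \<open>s\<close> exist everywhere, and it is stable under subtracting a chain of smooth functions.
\<close>

definition sobolev_chain :: "nat \<Rightarrow> (nat \<Rightarrow> real \<Rightarrow> complex) \<Rightarrow> bool" where
  "sobolev_chain s F \<longleftrightarrow>
     (\<forall>l<s. abs_continuous_on 0 1 (F l) \<and>
        (AE x in lebesgue. x \<in> {0..1} \<longrightarrow> (F l has_vector_derivative F (Suc l) x) (at x within {0..1}))) \<and>
     square_integrable (F s)"

lemma sobolev_chainD:
  assumes "sobolev_chain s F"
  shows "l < s \<Longrightarrow> abs_continuous_on 0 1 (F l)"
    "l < s \<Longrightarrow> AE x in lebesgue. x \<in> {0..1} \<longrightarrow> (F l has_vector_derivative F (Suc l) x) (at x within {0..1})"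
    "l < s \<Longrightarrow> continuous_on {0..1} (F l)"
    "l \<le> s \<Longrightarrow> square_integrable (F l)"
    "l < s \<Longrightarrow> 0 \<le> u \<Longrightarrow> u \<le> v \<Longrightarrow> v \<le> 1 \<Longrightarrow> (F (Suc l) has_integral (F l v - F l u)) {u..v}"
proof -
  show ac: "abs_continuous_on 0 1 (F l)" if "l < s" for l using assms that unfolding sobolev_chain_def by blast
  show d: "AE x in lebesgue. x \<in> {0..1} \<longrightarrow> (F l has_vector_derivative F (Suc l) x) (at x within {0..1})" if "l < s" for l
    using assms that unfolding sobolev_chain_def by blast
  show cont: "continuous_on {0..1} (F l)" if "l < s" for l by (rule abs_continuous_on_imp_continuous[OF ac[OF that]])
  show "square_integrable (F l)" if "l \<le> s"
    using assms that cont square_integrable_continuous unfolding sobolev_chain_def by (cases "l = s") auto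
  show "(F (Suc l) has_integral (F l v - F l u)) {u..v}" if "l < s" "0 \<le> u" "u \<le> v" "v \<le> 1"
  proof -
    note ftc = abs_continuous_fundamental_theorem(2)[OF zero_less_one ac[OF that(1)] d[OF that(1)]]
    have v: "(F (Suc l) has_integral (F l v - F l 0)) {0..v}" using ftc[of v] that by simp
    have u: "(F (Suc l) has_integral (F l u - F l 0)) {0..u}" using ftc[of u] that by simp
    have i: "F (Suc l) integrable_on {u..v}"
      using integrable_on_subinterval[OF has_integral_integrable[OF v], of u v] that by auto
    have "integral {0..u} (F (Suc l)) + integral {u..v} (F (Suc l)) = integral {0..v} (F (Suc l))"
      using that has_integral_integrable[OF v] by (intro Henstock_Kurzweil_Integration.integral_combine) auto
    then have "integral {u..v} (F (Suc l)) = F l v - F l u"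
      using u v by (simp add: integral_unique algebra_simps)
    then show ?thesis using i by (simp add: has_integral_iff)
  qed
qed

lemma Hspace_sobolev_chain:
  assumes f: "f \<in> Hspace s" and s: "1 \<le> s"
  shows "sobolev_chain s (\<lambda>l. nderiv l f)"
proof -
  have diff: "nderiv l f differentiable (at x within {0..1})" if "Suc l < s" "x \<in> {0..1}" for l x
    using f that unfolding Hspace_def by blast
  have ac: "abs_continuous_on 0 1 (nderiv (s - 1) f)" using f unfolding Hspace_def by blast
  have vd: "(nderiv l f has_vector_derivative nderiv (Suc l) f x) (at x within {0..1})"
    if "nderiv l f differentiable (at x within {0..1})" "x \<in> {0..1}" for l x
    using that by (simp add: vector_derivative_works)
  have cont: "continuous_on {0..1} (nderiv l f)" if "l < s" for l
  proof (cases "Suc l < s")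
    case True
    then show ?thesis
      using diff by (auto simp: continuous_on_eq_continuous_within intro: differentiable_imp_continuous_within)
  next
    case False
    then have "l = s - 1" using that by simp
    then show ?thesis using abs_continuous_on_imp_continuous[OF ac] by simp
  qed
  have "abs_continuous_on 0 1 (nderiv l f) \<and> (AE x in lebesgue. x \<in> {0..1} \<longrightarrow>
      (nderiv l f has_vector_derivative nderiv (Suc l) f x) (at x within {0..1}))" if "l < s" for l
  proof (cases "Suc l < s")
    case True
    then have "(nderiv l f has_vector_derivative nderiv (Suc l) f x) (at x within {0..1})" if "x \<in> {0..1}" for x
      using vd diff that by blast
    then show ?thesis using abs_continuous_on_C1[OF _ cont[OF True]] by blast
  next
    case False
    then have l: "l = s - 1" using that by simp
    have "AE x in lebesgue. x \<in> {0..1} \<longrightarrow> nderiv l f differentiable (at x within {0..1})"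
      unfolding l by (rule abs_continuous_differentiable_ae[OF zero_less_one ac])
    then show ?thesis using ac vd unfolding l by (auto elim!: eventually_mono simp del: nderiv.simps)
  qed
  moreover have "square_integrable (nderiv s f)"
    unfolding square_integrable_def
  proof
    show "nderiv s f \<in> borel_measurable (lebesgue_on {0..1})"
      using f unfolding Hspace_def set_borel_measurable_def
      by (subst borel_measurable_restrict_space_iff) auto
    show "(\<lambda>x. (cmod (nderiv s f x))\<^sup>2) integrable_on {0..1}"
      using f unfolding Hspace_def by (auto intro: set_lebesgue_integral_eq_integral(1))
  qed
  ultimately show ?thesis unfolding sobolev_chain_def by blast
qed

lemma Hnorm_le_1:
  assumes f: "f \<in> Hspace s" and s: "1 \<le> s" and le: "Hnorm s f \<le> 1"
  shows "(\<Sum>l<s. (cmod (integral {0..1} (nderiv l f)))\<^sup>2) + l2_energy (nderiv s f) \<le> 1"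
proof -
  note c = sobolev_chainD[OF Hspace_sobolev_chain[OF f s]]
  have ai: "nderiv l f absolutely_integrable_on {0..1}" if "l \<le> s" for l
    using square_integrable_imp_absolutely_integrable[OF c(4)[OF that]] .
  have cnj: "(LINT x:{0..1}|lebesgue. cnj (g x)) = cnj (LINT x:{0..1}|lebesgue. g x)" for g :: "real \<Rightarrow> complex"
  proof -
    have "indicat_real {0..1} x *\<^sub>R cnj (g x) = cnj (indicat_real {0..1} x *\<^sub>R g x)" for x by simp
    then show ?thesis unfolding set_lebesgue_integral_def by (simp only: Bochner_Integration.integral_cnj)
  qed
  have 1: "(LINT x:{0..1}|lebesgue. nderiv l f x) * (LINT x:{0..1}|lebesgue. cnj (nderiv l f x)) =
      of_real ((cmod (integral {0..1} (nderiv l f)))\<^sup>2)" if "l \<le> s" for l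
    unfolding cnj set_lebesgue_integral_eq_integral(2)[OF ai[OF that]] by (simp only: complex_norm_square)
  have "(\<lambda>x. (cmod (nderiv s f x))\<^sup>2) absolutely_integrable_on {0..1}"
    using f unfolding Hspace_def by blast
  then have 2: "(LINT x:{0..1}|lebesgue. (cmod (nderiv s f x))\<^sup>2) = l2_energy (nderiv s f)"
    unfolding l2_energy_def by (rule set_lebesgue_integral_eq_integral(2))
  have 3: "(LINT x:{0..1}|lebesgue. nderiv s f x * cnj (nderiv s f x)) = of_real (l2_energy (nderiv s f))"
    unfolding 2[symmetric] complex_norm_square[symmetric]
    unfolding set_lebesgue_integral_def integral_complex_of_real[symmetric]
    by (intro Bochner_Integration.integral_cong) (auto simp: indicator_def)
  have "Hinner s f f = of_real ((\<Sum>l<s. (cmod (integral {0..1} (nderiv l f)))\<^sup>2) + l2_energy (nderiv s f))"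
    unfolding Hinner_def 3 using 1 by simp
  then show ?thesis using le unfolding Hnorm_def by simp
qed

text \<open>
  An increment of \<open>F l\<close> is an integral of \<open>F (Suc l)\<close>, bounded by its \<open>L\<^sup>1\<close> norm and therefore by
  its \<open>L\<^sup>2\<close> norm.
\<close>

lemma sobolev_chain_oscillation:
  assumes F: "sobolev_chain s F" and l: "l < s" and xy: "x \<in> {0..1}" "y \<in> {0..1}"
  shows "cmod (F l x - F l y) \<le> sqrt (l2_energy (F (Suc l)))"
proof -
  note c = sobolev_chainD[OF F]
  let ?E = "l2_energy (F (Suc l))"
  have sq: "square_integrable (F (Suc l))" using c(4) l by auto
  have "F (Suc l) absolutely_integrable_on {0..1}"
    by (rule square_integrable_imp_absolutely_integrable[OF sq])
  then have n1: "(\<lambda>x. cmod (F (Suc l) x)) integrable_on {0..1}" by (simp add: absolutely_integrable_on_def)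
  have lt: "cmod (F l v - F l u) \<le> sqrt ?E" if "0 \<le> u" "u \<le> v" "v \<le> 1" for u v
  proof -
    have i: "F (Suc l) integrable_on {u..v}" "(\<lambda>x. cmod (F (Suc l) x)) integrable_on {u..v}"
      using integrable_on_subinterval[OF n1] c(5)[OF l that] that by (auto simp: has_integral_iff)
    have "cmod (F l v - F l u) = cmod (integral {u..v} (F (Suc l)))"
      using c(5)[OF l that] by (simp add: integral_unique)
    also have "\<dots> \<le> integral {u..v} (\<lambda>x. cmod (F (Suc l) x))"
      using i by (intro Henstock_Kurzweil_Integration.integral_norm_bound_integral) auto
    also have "\<dots> \<le> integral {0..1} (\<lambda>x. cmod (F (Suc l) x))"
      using i n1 that by (intro integral_subset_le) auto
    also have "\<dots> \<le> sqrt ?E" by (rule l1_le_l2[OF sq])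
    finally show ?thesis .
  qed
  show ?thesis using lt[of x y] lt[of y x] xy by (cases "x \<le> y") (auto simp: norm_minus_commute)
qed

text \<open>
  A Poincare inequality with the crude constant \<open>1\<close>: the deviation of \<open>F l\<close> from its mean is at most
  its oscillation. The constant suffices for the telescoping in the next lemma, because there the
  squared means are exactly the terms that the norm of \<open>H\<^sup>s\<close> provides.
\<close>

lemma sobolev_chain_poincare:
  assumes F: "sobolev_chain s F" and l: "l < s"
  shows "l2_energy (F l) \<le> (cmod (integral {0..1} (F l)))\<^sup>2 + l2_energy (F (Suc l))"
proof -
  note c = sobolev_chainD[OF F]
  let ?m = "integral {0..1} (F l)" and ?E = "l2_energy (F (Suc l))"
  have sq: "square_integrable (F l)" using c(4) l by auto
  have Fi: "F l integrable_on {0..1}" using c(3)[OF l] by (rule integrable_continuous_interval)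
  have "cmod (F l x - ?m) \<le> sqrt ?E" if x: "x \<in> {0..1}" for x
  proof -
    have "((\<lambda>y::real. F l x) has_integral F l x) {0..1}"
      using has_integral_const_real[of "F l x" 0 1] by simp
    note hi = has_integral_diff[OF this integrable_integral[OF Fi]]
    have "cmod (F l x - F l y) \<le> sqrt ?E" if "y \<in> {0..1}" for y
      using sobolev_chain_oscillation[OF F l x that] .
    from has_integral_bound_real[OF _ finite.emptyI hi] this
    have "cmod (F l x - ?m) \<le> sqrt ?E * measure lborel {0..1::real}" by simp
    then show ?thesis by simp
  qed
  then have "(cmod (F l x - ?m))\<^sup>2 \<le> ?E" if "x \<in> {0..1}" for x
    using that power_mono[of "cmod (F l x - ?m)" "sqrt ?E" 2] by simp
  then have "l2_energy (\<lambda>x. F l x - ?m) \<le> integral {0..1} (\<lambda>x::real. ?E)"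
    unfolding l2_energy_def using l2_energy_diff_mean(1)[OF sq]
    by (intro integral_le) (auto simp: square_integrable_def)
  then show ?thesis using l2_energy_diff_mean(2)[OF sq] by simp
qed

lemma sobolev_chain_energy_le:
  assumes F: "sobolev_chain s F" and n: "n \<le> s"
  shows "l2_energy (F n) \<le> (\<Sum>l=n..<s. (cmod (integral {0..1} (F l)))\<^sup>2) + l2_energy (F s)"
  using n
proof (induction n rule: inc_induct)
  case (step n)
  have "(\<Sum>l=n..<s. (cmod (integral {0..1} (F l)))\<^sup>2) =
      (cmod (integral {0..1} (F n)))\<^sup>2 + (\<Sum>l=Suc n..<s. (cmod (integral {0..1} (F l)))\<^sup>2)"
    using step by (intro sum.atLeast_Suc_lessThan)
  then show ?case using sobolev_chain_poincare[OF F step(2)] step(3) by linarith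
qed simp

lemma unit_ball_energy_le_1:
  assumes f: "f \<in> Hspace s" and s: "1 \<le> s" and le: "Hnorm s f \<le> 1" and n: "n \<le> s"
  shows "l2_energy (nderiv n f) \<le> 1"
proof -
  have "l2_energy (nderiv n f) \<le> (\<Sum>l=n..<s. (cmod (integral {0..1} (nderiv l f)))\<^sup>2) + l2_energy (nderiv s f)"
    by (rule sobolev_chain_energy_le[OF Hspace_sobolev_chain[OF f s] n])
  also have "(\<Sum>l=n..<s. (cmod (integral {0..1} (nderiv l f)))\<^sup>2) \<le> (\<Sum>l<s. (cmod (integral {0..1} (nderiv l f)))\<^sup>2)"
    by (intro sum_mono2) auto
  finally show ?thesis using Hnorm_le_1[OF f s le] by simp
qed

section \<open>Bernoulli polynomials\<close>

text \<open>
  Bernoulli polynomials are the preimages of the monomials under \<open>p \<mapsto> (t \<mapsto> \<integral> p\<close> over \<open>[t, t + 1])\<close>,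
  so their existence and all identities below come from this linear operator being bijective.
\<close>

definition poly_window :: "real poly \<Rightarrow> real \<Rightarrow> real" where
  "poly_window p t = (LINT x:{t..t+1}|lebesgue. poly p x)"

lemma poly_window_pderiv: "poly_window (pderiv q) t = poly q (t + 1) - poly q t"
proof -
  have "continuous_on {t..t+1} (poly (pderiv q))" by (intro continuous_intros)
  then have "poly (pderiv q) absolutely_integrable_on {t..t+1}" by (rule absolutely_integrable_continuous_real)
  then have "poly_window (pderiv q) t = integral {t..t+1} (poly (pderiv q))"
    unfolding poly_window_def by (rule set_lebesgue_integral_eq_integral(2))
  also have "\<dots> = poly q (t + 1) - poly q t"
    by (intro integral_unique fundamental_theorem_of_calculus)
      (auto simp flip: has_real_derivative_iff_has_vector_derivative intro: has_field_derivative_at_within poly_DERIV)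
  finally show ?thesis .
qed

lemma pderiv_sum: "pderiv (\<Sum>i\<in>A. f i) = (\<Sum>i\<in>A. pderiv (f i))"
  by (induction A rule: infinite_finite_induct) (simp_all add: pderiv_add)

lemma poly_antiderivative: "\<exists>q. pderiv q = (p :: real poly)"
proof
  have "pderiv (\<Sum>i\<le>degree p. monom (coeff p i / real (Suc i)) (Suc i)) = (\<Sum>i\<le>degree p. monom (coeff p i) i)"
    unfolding pderiv_sum by (intro sum.cong) (simp_all add: pderiv_monom)
  also have "\<dots> = p" by (rule poly_as_sum_of_monoms)
  finally show "pderiv (\<Sum>i\<le>degree p. monom (coeff p i / real (Suc i)) (Suc i)) = p" .
qed

lemma poly_window_diff: "poly_window (p - q) t = poly_window p t - poly_window q t"
proof -
  obtain P Q where "pderiv P = p" "pderiv Q = q" using poly_antiderivative by metis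
  then show ?thesis using poly_window_pderiv[of "P - Q"] poly_window_pderiv[of P] poly_window_pderiv[of Q]
    by (simp add: pderiv_diff)
qed

lemma poly_window_smult: "poly_window (smult c p) t = c * poly_window p t"
proof -
  obtain P where "pderiv P = p" using poly_antiderivative by metis
  then show ?thesis using poly_window_pderiv[of "smult c P"] poly_window_pderiv[of P]
    by (simp add: pderiv_smult right_diff_distrib)
qed

lemma poly_window_sum: "poly_window (\<Sum>i\<in>A. f i) t = (\<Sum>i\<in>A. poly_window (f i) t)"
proof -
  have "\<forall>i. \<exists>q. pderiv q = f i" using poly_antiderivative by blast
  then obtain F where F: "\<And>i. pderiv (F i) = f i" by metis
  show ?thesis using poly_window_pderiv[of "\<Sum>i\<in>A. F i"] poly_window_pderiv[of "F _"]
    by (simp add: pderiv_sum F poly_sum sum_subtractf)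
qed

text \<open>
  If the window of \<open>p - q\<close> vanishes, an antiderivative of \<open>p - q\<close> is \<open>1\<close>-periodic, and a periodic
  polynomial is constant.
\<close>

lemma poly_window_inj:
  assumes "\<And>t. poly_window p t = poly_window q t"
  shows "p = q"
proof -
  obtain r where r: "pderiv r = p - q" using poly_antiderivative by blast
  have "poly r (t + 1) = poly r t" for t
    using poly_window_pderiv[of r t] assms unfolding r poly_window_diff by simp
  then have "poly r (real n) = poly r 0" for n by (induction n) (simp_all add: add.commute[of 1])
  then have "range real \<subseteq> {x. poly (r - [:poly r 0:]) x = 0}" by auto
  then have "infinite {x. poly (r - [:poly r 0:]) x = 0}"
    using infinite_UNIV_char_0[where 'a = nat] finite_subset finite_imageD[OF _ inj_of_nat] by blast
  then have "r - [:poly r 0:] = 0" using poly_roots_finite by blast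
  then have "pderiv r = 0" by (metis pderiv_pCons pderiv_0 eq_iff_diff_eq_0 pCons_0_0 add_0)
  then show ?thesis using r by simp
qed

text \<open>
  By the binomial theorem the window of \<open>x\<^sup>m\<close> is \<open>t\<^sup>m\<close> plus a combination of lower powers, which are
  removed by induction.
\<close>

lemma poly_window_surj_monomial: "\<exists>p. \<forall>t. poly_window p t = t ^ m"
proof (induction m rule: less_induct)
  case (less m)
  then obtain B where B: "\<And>k t. k < m \<Longrightarrow> poly_window (B k) t = t ^ k" by metis
  let ?c = "\<lambda>k. real (Suc m choose k) / real (Suc m)"
  show ?case
  proof (intro exI allI)
    fix t
    have "poly_window (monom 1 m) t = ((t + 1) ^ Suc m - t ^ Suc m) / real (Suc m)"
      using poly_window_pderiv[of "monom (1 / real (Suc m)) (Suc m)" t]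
      by (simp add: pderiv_monom poly_monom diff_divide_distrib)
    also have "(t + 1) ^ Suc m = (\<Sum>k\<le>Suc m. real (Suc m choose k) * t ^ k)"
      using binomial_ring[of t 1 "Suc m"] by simp
    also have "\<dots> = (\<Sum>k<m. real (Suc m choose k) * t ^ k) + real (Suc m) * t ^ m + t ^ Suc m"
      by (simp flip: lessThan_Suc_atMost)
    finally have "poly_window (monom 1 m) t = (\<Sum>k<m. ?c k * t ^ k) + t ^ m"
      by (simp add: add_divide_distrib sum_divide_distrib del: binomial_Suc_Suc)
    then show "poly_window (monom 1 m - (\<Sum>k<m. smult (?c k) (B k))) t = t ^ m"
      using B by (simp add: poly_window_diff poly_window_sum poly_window_smult)
  qed
qed

lemma poly_window_bernoulli: "poly_window (bernoulli_poly m) t = t ^ m"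
proof -
  have "\<exists>!p. \<forall>t. poly_window p t = t ^ m"
    using poly_window_surj_monomial[of m] poly_window_inj by (metis (no_types, lifting))
  from theI'[OF this] show ?thesis unfolding bernoulli_poly_def poly_window_def by blast
qed

lemma bernoulli_poly_0: "bernoulli_poly 0 = 1"
proof (rule poly_window_inj)
  have "pderiv [:0, 1:] = (1 :: real poly)" by (simp add: pderiv_pCons)
  then show "poly_window (bernoulli_poly 0) t = poly_window 1 t" for t
    using poly_window_pderiv[of "[:0, 1:]" t] by (simp add: poly_window_bernoulli)
qed

text \<open>
  Differentiate both sides of the defining identity for \<open>Suc m\<close> with respect to \<open>t\<close>.
\<close>

lemma bernoulli_poly_difference:
  "poly (bernoulli_poly (Suc m)) (t + 1) - poly (bernoulli_poly (Suc m)) t = real (Suc m) * t ^ m"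
proof -
  obtain q where q: "pderiv q = bernoulli_poly (Suc m)" using poly_antiderivative by blast
  have "((\<lambda>t. poly q (t + 1) - poly q t) has_real_derivative
      poly (pderiv q) (t + 1) - poly (pderiv q) t) (at t)"
    by (auto intro!: derivative_eq_intros DERIV_chain2[of "poly q"] poly_DERIV)
  moreover have "(\<lambda>t. poly q (t + 1) - poly q t) = (\<lambda>t. t ^ Suc m)"
    using poly_window_pderiv[of q] by (simp add: q poly_window_bernoulli fun_eq_iff)
  ultimately have "((\<lambda>t. t ^ Suc m) has_real_derivative
      poly (pderiv q) (t + 1) - poly (pderiv q) t) (at t)" by simp
  moreover have "((\<lambda>t. t ^ Suc m) has_real_derivative real (Suc m) * t ^ m) (at t)"
    using DERIV_pow[of "Suc m" t] by simp
  ultimately show ?thesis unfolding q by (rule DERIV_unique)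
qed

lemma pderiv_bernoulli_poly: "pderiv (bernoulli_poly (Suc m)) = smult (real (Suc m)) (bernoulli_poly m)"
  by (rule poly_window_inj)
    (simp only: poly_window_pderiv poly_window_smult poly_window_bernoulli bernoulli_poly_difference)

lemma bernoulli_normalized_0 [simp]: "bernoulli_normalized 0 x = 1"
  by (simp add: bernoulli_normalized_def bernoulli_poly_0)

text \<open>
  Among the normalized Bernoulli polynomials of positive degree only the one of degree \<open>1\<close> has
  different values at \<open>0\<close> and \<open>1\<close>. Hence in the \<open>l\<close>-th derivative of the periodizer exactly one term
  jumps, and it jumps by the amount by which \<open>f\<close> does.
\<close>

lemma bernoulli_normalized_jump:
  "bernoulli_normalized (Suc m) 1 - bernoulli_normalized (Suc m) 0 = (if m = 0 then 1 else 0)"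
  using bernoulli_poly_difference[of m 0]
  by (auto simp: bernoulli_normalized_def simp flip: diff_divide_distrib)

lemma bernoulli_normalized_DERIV:
  "(bernoulli_normalized (Suc m) has_real_derivative bernoulli_normalized m x) (at x)"
proof -
  have "((\<lambda>x. poly (bernoulli_poly (Suc m)) x / fact (Suc m)) has_real_derivative
      poly (pderiv (bernoulli_poly (Suc m))) x / fact (Suc m)) (at x)"
    by (intro DERIV_cdivide poly_DERIV)
  also have "poly (pderiv (bernoulli_poly (Suc m))) x / fact (Suc m) = bernoulli_normalized m x"
    unfolding pderiv_bernoulli_poly by (simp add: bernoulli_normalized_def divide_simps del: of_nat_Suc)
  finally show ?thesis unfolding bernoulli_normalized_def[abs_def] .
qed

section \<open>The periodizer\<close>

text \<open>
  The \<open>l\<close>-th derivative of the periodizer. Terms whose degree \<open>Suc m\<close> is below \<open>l\<close> have been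
  differentiated away; the case distinction is needed because truncated subtraction would turn them
  into the constant \<open>bernoulli_normalized 0\<close>.
\<close>

definition periodizer_deriv :: "nat \<Rightarrow> (real \<Rightarrow> complex) \<Rightarrow> nat \<Rightarrow> real \<Rightarrow> complex" where
  "periodizer_deriv s f l x = (\<Sum>m<s. if l \<le> Suc m
     then (nderiv m f 1 - nderiv m f 0) * of_real (bernoulli_normalized (Suc m - l) x) else 0)"

lemma periodizer_deriv_0: "periodizer_deriv s f 0 = periodizer s f"
  by (simp add: periodizer_deriv_def periodizer_def fun_eq_iff)

lemma periodizer_deriv_has_derivative:
  "(periodizer_deriv s f l has_vector_derivative periodizer_deriv s f (Suc l) x) (at x)"
  unfolding periodizer_deriv_def[abs_def]
proof (rule has_vector_derivative_sum)
  fix m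
  let ?d = "nderiv m f 1 - nderiv m f 0"
  consider "l \<le> m" | "l = Suc m" | "l > Suc m" by linarith
  then show "((\<lambda>x. if l \<le> Suc m then ?d * of_real (bernoulli_normalized (Suc m - l) x) else 0)
      has_vector_derivative (if Suc l \<le> Suc m then ?d * of_real (bernoulli_normalized (Suc m - Suc l) x) else 0)) (at x)"
  proof cases
    case 1
    from has_vector_derivative_mult_right[OF has_vector_derivative_of_real[OF bernoulli_normalized_DERIV]]
    show ?thesis using 1 by (simp add: Suc_diff_le)
  qed auto
qed

lemma periodizer_deriv_jump:
  assumes "l < s"
  shows "periodizer_deriv s f l 1 - periodizer_deriv s f l 0 = nderiv l f 1 - nderiv l f 0"
proof -
  have "periodizer_deriv s f l 1 - periodizer_deriv s f l 0 =
      (\<Sum>m<s. if m = l then nderiv m f 1 - nderiv m f 0 else 0)"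
    unfolding periodizer_deriv_def sum_subtractf[symmetric]
  proof (intro sum.cong refl)
    fix m
    consider "l \<le> m" | "l = Suc m" | "l > Suc m" by linarith
    then show "(if l \<le> Suc m then (nderiv m f 1 - nderiv m f 0) * of_real (bernoulli_normalized (Suc m - l) 1) else 0) -
        (if l \<le> Suc m then (nderiv m f 1 - nderiv m f 0) * of_real (bernoulli_normalized (Suc m - l) 0) else 0) =
        (if m = l then nderiv m f 1 - nderiv m f 0 else 0)"
    proof cases
      case 1
      then show ?thesis
        using bernoulli_normalized_jump[of "m - l"]
        by (simp add: Suc_diff_le flip: right_diff_distrib of_real_diff)
    qed auto
  qed
  also have "\<dots> = nderiv l f 1 - nderiv l f 0" using assms by simp
  finally show ?thesis .
qed

text \<open>
  Only the term of degree \<open>s\<close> survives \<open>s\<close> differentiations. The constant that is left is the mean of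
  the \<open>s\<close>-th derivative of \<open>f\<close>, so subtracting the periodizer does not enlarge the \<open>L\<^sup>2\<close> norm of
  that derivative.
\<close>

lemma periodizer_deriv_top:
  assumes "1 \<le> s"
  shows "periodizer_deriv s f s x = nderiv (s - 1) f 1 - nderiv (s - 1) f 0"
proof -
  have "periodizer_deriv s f s x = (\<Sum>m<s. if m = s - 1 then nderiv m f 1 - nderiv m f 0 else 0)"
    unfolding periodizer_deriv_def using assms by (intro sum.cong) auto
  then show ?thesis using assms by simp
qed

lemma periodized_chain:
  assumes f: "f \<in> Hspace s" and s: "1 \<le> s"
  defines "G \<equiv> \<lambda>l x. nderiv l f x - periodizer_deriv s f l x"
  shows "sobolev_chain s G" and "l < s \<Longrightarrow> G l 0 = G l 1"
    and "l2_energy (G s) \<le> l2_energy (nderiv s f)"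
proof -
  note F = Hspace_sobolev_chain[OF f s]
  note c = sobolev_chainD[OF F]
  show "G l 0 = G l 1" if "l < s"
    using periodizer_deriv_jump[OF that, of f] unfolding G_def by (simp add: algebra_simps)
  have cont: "continuous_on A (periodizer_deriv s f l)" for A l
    using periodizer_deriv_has_derivative
    by (meson continuous_at_imp_continuous_on has_vector_derivative_continuous)
  have "nderiv s f = nderiv (Suc (s - 1)) f" using s by simp
  moreover have "(nderiv (Suc (s - 1)) f has_integral (nderiv (s - 1) f 1 - nderiv (s - 1) f 0)) {0..1}"
    using s by (intro c(5)) auto
  ultimately have "integral {0..1} (nderiv s f) = nderiv (s - 1) f 1 - nderiv (s - 1) f 0"
    by (simp only: integral_unique)
  then have Gs: "G s = (\<lambda>x. nderiv s f x - integral {0..1} (nderiv s f))"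
    unfolding G_def periodizer_deriv_top[OF s] by simp
  have sq: "square_integrable (nderiv s f)" using c(4) by blast
  show "l2_energy (G s) \<le> l2_energy (nderiv s f)"
    unfolding Gs l2_energy_diff_mean(2)[OF sq] by simp
  have "abs_continuous_on 0 1 (G l) \<and>
      (AE x in lebesgue. x \<in> {0..1} \<longrightarrow> (G l has_vector_derivative G (Suc l) x) (at x within {0..1}))" if "l < s" for l
  proof
    show "abs_continuous_on 0 1 (G l)"
      unfolding G_def
      by (intro abs_continuous_on_diff c(1) that abs_continuous_on_C1[OF _ cont[of _ "Suc l"]]
          has_vector_derivative_at_within[OF periodizer_deriv_has_derivative])
    show "AE x in lebesgue. x \<in> {0..1} \<longrightarrow> (G l has_vector_derivative G (Suc l) x) (at x within {0..1})"
      using c(2)[OF that] unfolding G_def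
      by eventually_elim
        (intro impI has_vector_derivative_diff has_vector_derivative_at_within[OF periodizer_deriv_has_derivative], blast)
  qed
  then show "sobolev_chain s G"
    unfolding sobolev_chain_def using Gs l2_energy_diff_mean(1)[OF sq] by simp
qed

section \<open>Fourier coefficients\<close>

text \<open>
  The sign in the exponent makes \<open>\<integral> f \<cdot> fourier_char k\<close> the \<open>k\<close>-th Fourier coefficient of \<open>f\<close>.
\<close>

definition fourier_char :: "int \<Rightarrow> real \<Rightarrow> complex" where
  "fourier_char k x = exp (- 2 * of_real pi * \<i> * of_int k * of_real x)"

lemma norm_fourier_char [simp]: "cmod (fourier_char k x) = 1"
  unfolding fourier_char_def by (simp add: norm_exp_eq_Re)

lemma fourier_char_has_derivative:
  "(fourier_char k has_vector_derivative (- 2 * of_real pi * \<i> * of_int k) * fourier_char k x) (at x within A)"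
proof -
  have "((\<lambda>z. exp ((- 2 * of_real pi * \<i> * of_int k) * z)) has_field_derivative
      (- 2 * of_real pi * \<i> * of_int k) * fourier_char k x) (at (of_real x))"
    unfolding fourier_char_def by (auto intro!: derivative_eq_intros)
  from has_vector_derivative_real_field[OF this] show ?thesis
    unfolding fourier_char_def[abs_def] by (auto intro: has_vector_derivative_at_within)
qed

lemma continuous_on_fourier_char [continuous_intros]: "continuous_on A (fourier_char k)"
  unfolding fourier_char_def[abs_def] by (intro continuous_intros)

lemma fourier_int_eq:
  assumes "continuous_on {0..1} f"
  shows "fourier_int k f = integral {0..1} (\<lambda>x. f x * fourier_char k x)"
proof -
  have "(\<lambda>x. f x * fourier_char k x) absolutely_integrable_on {0..1}"
    by (intro absolutely_integrable_continuous_real continuous_intros assms)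
  from set_lebesgue_integral_eq_integral(2)[OF this] show ?thesis
    unfolding fourier_int_def fourier_char_def .
qed

lemma fourier_int_diff:
  assumes "continuous_on {0..1} f" "continuous_on {0..1} g"
  shows "fourier_int k f - fourier_int k g = integral {0..1} (\<lambda>x. (f x - g x) * fourier_char k x)"
  unfolding fourier_int_eq[OF assms(1)] fourier_int_eq[OF assms(2)] left_diff_distrib
  by (intro Henstock_Kurzweil_Integration.integral_diff[symmetric] integrable_continuous_interval
      continuous_intros assms)

section \<open>The Taylor algorithm\<close>

text \<open>
  The first \<open>k\<close> Taylor terms at \<open>c\<close> of the \<open>l\<close>-th member of a chain. Keeping \<open>l\<close> as a parameter makes
  differentiation act by \<open>(l, k) \<mapsto> (Suc l, k - 1)\<close>.
\<close>

definition taylor_part :: "(nat \<Rightarrow> real \<Rightarrow> complex) \<Rightarrow> real \<Rightarrow> nat \<Rightarrow> nat \<Rightarrow> real \<Rightarrow> complex" where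
  "taylor_part F c l k x = (\<Sum>i<k. F (l + i) c / fact i * of_real ((x - c) ^ i))"

lemma taylor_part_has_derivative:
  "(taylor_part F c l (Suc k) has_vector_derivative taylor_part F c (Suc l) k x) (at x within A)"
proof -
  have eq: "taylor_part F c l (Suc k) =
      (\<lambda>x. F l c + (\<Sum>i<k. F (Suc l + i) c / fact (Suc i) * of_real ((x - c) ^ Suc i)))"
    unfolding taylor_part_def by (subst sum.lessThan_Suc_shift) simp
  have "((\<lambda>x. F (Suc l + i) c / fact (Suc i) * of_real ((x - c) ^ Suc i)) has_vector_derivative
      F (Suc l + i) c / fact i * of_real ((x - c) ^ i)) (at x within A)" for i
  proof -
    have "((\<lambda>x. (x - c) ^ Suc i) has_real_derivative real (Suc i) * (x - c) ^ i) (at x within A)"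
      by (auto intro!: derivative_eq_intros simp del: power_Suc of_nat_Suc)
    from has_vector_derivative_mult_right[OF has_vector_derivative_of_real[OF this],
        of "F (Suc l + i) c / fact (Suc i)"]
    show ?thesis by (simp add: divide_simps del: of_nat_Suc power_Suc)
  qed
  then have "((\<lambda>x. \<Sum>i<k. F (Suc l + i) c / fact (Suc i) * of_real ((x - c) ^ Suc i)) has_vector_derivative
      taylor_part F c (Suc l) k x) (at x within A)"
    unfolding taylor_part_def by (intro has_vector_derivative_sum)
  from has_vector_derivative_add[OF has_vector_derivative_const[of "F l c"] this] show ?thesis
    unfolding eq by simp
qed

lemma has_integral_abs_power:
  fixes c :: real
  assumes "c \<le> x"
  shows "((\<lambda>y. \<bar>y - c\<bar> ^ j / fact j) has_integral (x - c) ^ Suc j / fact (Suc j)) {c..x}"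
    and "((\<lambda>y. \<bar>y - x\<bar> ^ j / fact j) has_integral (x - c) ^ Suc j / fact (Suc j)) {c..x}"
proof -
  have fact: "z * real (Suc j) / fact (Suc j) = z / fact j" for z :: real
    by (simp add: divide_simps del: of_nat_Suc)
  have "((\<lambda>y. (y - c) ^ Suc j / fact (Suc j)) has_real_derivative (y - c) ^ j / fact j) (at y within {c..x})" for y
  proof -
    have "((\<lambda>y. (y - c) ^ Suc j) has_real_derivative real (Suc j) * (y - c) ^ j) (at y within {c..x})"
      by (auto intro!: derivative_eq_intros simp del: power_Suc of_nat_Suc)
    from DERIV_cdivide[OF this, of "fact (Suc j)"] show ?thesis
      using fact[of "(y - c) ^ j"] by (simp only: mult.commute)
  qed
  then have "((\<lambda>y. (y - c) ^ j / fact j) has_integral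
      (x - c) ^ Suc j / fact (Suc j) - (c - c) ^ Suc j / fact (Suc j)) {c..x}"
    using assms by (intro fundamental_theorem_of_calculus)
      (simp_all flip: has_real_derivative_iff_has_vector_derivative)
  then show "((\<lambda>y. \<bar>y - c\<bar> ^ j / fact j) has_integral (x - c) ^ Suc j / fact (Suc j)) {c..x}"
    by (auto intro: has_integral_eq[rotated])
  have "((\<lambda>y. - ((x - y) ^ Suc j / fact (Suc j))) has_real_derivative (x - y) ^ j / fact j) (at y within {c..x})" for y
  proof -
    have "((\<lambda>y. - ((x - y) ^ Suc j)) has_real_derivative real (Suc j) * (x - y) ^ j) (at y within {c..x})"
      by (auto intro!: derivative_eq_intros simp del: power_Suc of_nat_Suc)
    from DERIV_cdivide[OF this, of "fact (Suc j)"] show ?thesis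
      using fact[of "(x - y) ^ j"] by (simp only: mult.commute minus_divide_left)
  qed
  then have "((\<lambda>y. (x - y) ^ j / fact j) has_integral
      - ((x - x) ^ Suc j / fact (Suc j)) - - ((x - c) ^ Suc j / fact (Suc j))) {c..x}"
    using assms by (intro fundamental_theorem_of_calculus)
      (simp_all flip: has_real_derivative_iff_has_vector_derivative)
  then show "((\<lambda>y. \<bar>y - x\<bar> ^ j / fact j) has_integral (x - c) ^ Suc j / fact (Suc j)) {c..x}"
    by (auto intro: has_integral_eq[rotated])
qed

lemma diff_diff_diff_swap: "(a - b) - (p - q) = (a - p) - (b - q)" for a b p q :: complex
  by simp

text \<open>
  The remainder vanishes at \<open>c\<close> and its derivative is the remainder of order one less, so the bound
  is integrated outward from \<open>c\<close> once per induction step. The induction starts from the oscillation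
  bound for \<open>F (n - 1)\<close>.
\<close>

lemma taylor_remainder_bound:
  assumes F: "sobolev_chain s F" and n: "n \<le> s" and c: "c \<in> {0..1}"
    and E: "l2_energy (F n) \<le> 1" and lk: "l + Suc k = n" and x: "x \<in> {0..1}"
  shows "cmod (F l x - taylor_part F c l (Suc k) x) \<le> \<bar>x - c\<bar> ^ k / fact k"
  using lk x
proof (induction k arbitrary: l x)
  case 0
  then have "cmod (F l x - F l c) \<le> sqrt (l2_energy (F n))"
    using sobolev_chain_oscillation[OF F _ _ c, of l x] n by simp
  also have "\<dots> \<le> 1" using E by simp
  finally show ?case by (simp add: taylor_part_def)
next
  case (Suc k)
  let ?R = "\<lambda>x. F l x - taylor_part F c l (Suc (Suc k)) x"
  have incr: "cmod (?R v - ?R u) \<le> I"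
    if uv: "0 \<le> u" "u \<le> v" "v \<le> 1" and I: "((\<lambda>y. \<bar>y - c\<bar> ^ k / fact k) has_integral I) {u..v}" for u v I
  proof -
    have "(F (Suc l) has_integral (F l v - F l u)) {u..v}"
      using Suc.prems n uv by (intro sobolev_chainD(5)[OF F]) auto
    moreover have "(taylor_part F c (Suc l) (Suc k) has_integral
        (taylor_part F c l (Suc (Suc k)) v - taylor_part F c l (Suc (Suc k)) u)) {u..v}"
      using uv by (intro fundamental_theorem_of_calculus taylor_part_has_derivative)
    ultimately have "((\<lambda>y. F (Suc l) y - taylor_part F c (Suc l) (Suc k) y) has_integral
        ((F l v - F l u) - (taylor_part F c l (Suc (Suc k)) v - taylor_part F c l (Suc (Suc k)) u))) {u..v}"
      by (rule has_integral_diff)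
    also have "(F l v - F l u) - (taylor_part F c l (Suc (Suc k)) v - taylor_part F c l (Suc (Suc k)) u) = ?R v - ?R u"
      by (rule diff_diff_diff_swap)
    finally have R: "((\<lambda>y. F (Suc l) y - taylor_part F c (Suc l) (Suc k) y) has_integral (?R v - ?R u)) {u..v}" .
    have "cmod (F (Suc l) y - taylor_part F c (Suc l) (Suc k) y) \<le> \<bar>y - c\<bar> ^ k / fact k" if "y \<in> {u..v}" for y
      using that uv Suc.prems(1) by (intro Suc.IH) auto
    then have "cmod (integral {u..v} (\<lambda>y. F (Suc l) y - taylor_part F c (Suc l) (Suc k) y)) \<le>
        integral {u..v} (\<lambda>y. \<bar>y - c\<bar> ^ k / fact k)"
      using R I by (intro Henstock_Kurzweil_Integration.integral_norm_bound_integral)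
        (auto simp only: has_integral_iff)
    then show ?thesis using R I by (simp only: integral_unique)
  qed
  have R0: "?R c = 0" by (simp add: taylor_part_def sum.lessThan_Suc_shift del: sum.lessThan_Suc)
  show ?case
  proof (cases "c \<le> x")
    case True
    have "cmod (?R x - ?R c) \<le> (x - c) ^ Suc k / fact (Suc k)"
      using True c Suc.prems by (intro incr has_integral_abs_power(1)) auto
    moreover have "\<bar>x - c\<bar> = x - c" using True by simp
    ultimately show ?thesis using R0 by (simp only: diff_zero)
  next
    case False
    then have "cmod (?R c - ?R x) \<le> (c - x) ^ Suc k / fact (Suc k)"
      using c Suc.prems by (intro incr has_integral_abs_power(2)) auto
    then have "cmod (?R x - ?R c) \<le> (c - x) ^ Suc k / fact (Suc k)"
      by (subst norm_minus_commute)
    moreover have "\<bar>x - c\<bar> = c - x" using False by simp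
    ultimately show ?thesis using R0 by (simp only: diff_zero)
  qed
qed

text \<open>
  A Fourier coefficient is at most the \<open>L\<^sup>1\<close> norm, and \<open>\<integral> |x - 1/2|\<^bsup>n-1\<^esup> / (n - 1)!\<close> over \<open>[0, 1]\<close> equals
  \<open>1 / (2\<^bsup>n-1\<^esup> n!)\<close>.
\<close>

lemma taylor_algorithm_error:
  assumes f: "f \<in> Hspace s" and le: "Hnorm s f \<le> 1" and n: "1 \<le> n" "n \<le> s"
  shows "cmod (fourier_int k f - fourier_int k (taylor_mid n f)) \<le> 1 / (2 ^ (n - 1) * fact n)"
proof -
  have s: "1 \<le> s" using n by simp
  let ?F = "\<lambda>l. nderiv l f"
  note F = Hspace_sobolev_chain[OF f s]
  obtain j where j: "n = Suc j" using n by (cases n) auto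
  have T: "taylor_mid n f = taylor_part ?F (1/2) 0 (Suc j)"
    unfolding j by (simp add: taylor_mid_def taylor_part_def fun_eq_iff)
  have contf: "continuous_on {0..1} f" using sobolev_chainD(3)[OF F, of 0] s by simp
  have contT: "continuous_on {0..1} (taylor_mid n f)"
    unfolding T taylor_part_def[abs_def] by (intro continuous_intros)
  have bound: "cmod (f x - taylor_mid n f x) \<le> \<bar>x - 1/2\<bar> ^ j / fact j" if "x \<in> {0..1}" for x
    using taylor_remainder_bound[OF F n(2) _ unit_ball_energy_le_1[OF f s le n(2)], of "1/2" 0 j x] that
    unfolding T by (simp add: j)
  have "((\<lambda>x. \<bar>x - 1/2\<bar> ^ j / fact j) has_integral (1/2 - 0) ^ Suc j / fact (Suc j)) {0..1/2::real}"
    "((\<lambda>x. \<bar>x - 1/2\<bar> ^ j / fact j) has_integral (1 - 1/2) ^ Suc j / fact (Suc j)) {1/2..1::real}"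
    by (rule has_integral_abs_power; simp)+
  from has_integral_combine[OF _ _ this]
  have I: "((\<lambda>x. \<bar>x - 1/2\<bar> ^ j / fact j) has_integral 1 / (2 ^ j * fact (Suc j))) {0..1::real}"
    by (simp add: power_divide mult.commute mult.left_commute)
  have "cmod (integral {0..1} (\<lambda>x. (f x - taylor_mid n f x) * fourier_char k x)) \<le>
      integral {0..1} (\<lambda>x::real. \<bar>x - 1/2\<bar> ^ j / fact j)"
    using I bound contf contT
    by (intro Henstock_Kurzweil_Integration.integral_norm_bound_integral integrable_continuous_interval continuous_intros)
      (auto simp: norm_mult)
  also have "\<dots> = 1 / (2 ^ j * fact (Suc j))" using I by (rule integral_unique)
  finally show ?thesis unfolding fourier_int_diff[OF contf contT] by (simp add: j)
qed

section \<open>Fourier coefficients of periodic chains\<close>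

lemma fourier_char_0 [simp]: "fourier_char m 0 = 1" "fourier_char 0 x = 1"
  by (simp_all add: fourier_char_def)

lemma fourier_char_add: "fourier_char (m + n) x = fourier_char m x * fourier_char n x"
  by (simp add: fourier_char_def ring_distribs flip: exp_add)

lemma fourier_char_mult_nat: "fourier_char (m * int N) x = fourier_char m (real N * x)"
  by (simp add: fourier_char_def mult_ac)

lemma fourier_char_cnj: "cnj (fourier_char m x) = fourier_char (- m) x"
  by (simp add: fourier_char_def exp_cnj)

lemma fourier_char_nat [simp]: "fourier_char m (real n) = 1"
proof -
  have "fourier_char m (real n) = exp (of_int (2 * (- m * int n)) * (of_real pi * \<i>))"
    by (simp add: fourier_char_def mult_ac)
  also have "\<dots> = 1" unfolding exp_eq_1 by (auto intro!: exI[of _ "- m * int n"])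
  finally show ?thesis .
qed

lemma fourier_char_1 [simp]: "fourier_char m 1 = 1"
  using fourier_char_nat[of m 1] by simp

lemma fourier_char_periodic: "fourier_char m (x + real n) = fourier_char m x"
proof -
  have "fourier_char m (x + real n) = fourier_char m x * fourier_char m (real n)"
    unfolding fourier_char_def by (simp add: ring_distribs flip: exp_add)
  then show ?thesis by simp
qed

lemma fourier_char_integral: "(fourier_char m has_integral (if m = 0 then 1 else 0)) {0..1}"
proof (cases "m = 0")
  case True
  then show ?thesis using has_integral_const_real[of "1::complex" 0 1] by (simp add: fourier_char_def[abs_def])
next
  case False
  let ?c = "- 2 * of_real pi * \<i> * of_int m :: complex"
  (* A nontrivial character has a periodic antiderivative, a multiple of itself. *)
  have "?c \<noteq> 0" using False by simp
  have "((\<lambda>x. fourier_char m x / ?c) has_vector_derivative fourier_char m x) (at x within {0..1})" for x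
    using has_vector_derivative_divide[OF fourier_char_has_derivative[of m x "{0..1}"], of ?c] \<open>?c \<noteq> 0\<close> by simp
  then have "(fourier_char m has_integral (fourier_char m 1 / ?c - fourier_char m 0 / ?c)) {0..1}"
    by (intro fundamental_theorem_of_calculus) auto
  then show ?thesis using False by simp
qed

text \<open>
  Integrating by parts \<open>s\<close> times; the boundary terms cancel because the chain is periodic below the
  top.
\<close>

lemma fourier_coefficient_chain:
  assumes G: "sobolev_chain s G" and per: "\<And>l. l < s \<Longrightarrow> G l 0 = G l 1" and m: "m \<noteq> 0"
  shows "integral {0..1} (\<lambda>x. G 0 x * fourier_char m x) =
    (1 / (2 * of_real pi * \<i> * of_int m)) ^ s * integral {0..1} (\<lambda>x. G s x * fourier_char m x)"
proof -
  let ?c = "2 * of_real pi * \<i> * of_int m :: complex"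
  have c: "?c \<noteq> 0" using m by simp
  note ch = sobolev_chainD[OF G]
  have step: "integral {0..1} (\<lambda>x. G l x * fourier_char m x) =
      (1 / ?c) * integral {0..1} (\<lambda>x. G (Suc l) x * fourier_char m x)" if l: "l < s" for l
  proof -
    have "((\<lambda>x. G (Suc l) x * fourier_char m x) has_integral (G l 1 * fourier_char m 1 - G l 0 * fourier_char m 0
        - integral {0..1} (\<lambda>x. G l x * ((- 2 * of_real pi * \<i> * of_int m) * fourier_char m x)))) {0..1}"
      by (intro abs_continuous_integration_by_parts ch(1,2) l fourier_char_has_derivative continuous_intros) simp
    also have "(\<lambda>x. G l x * ((- 2 * of_real pi * \<i> * of_int m) * fourier_char m x)) =
        (\<lambda>x. (- ?c) * (G l x * fourier_char m x))" by (simp add: fun_eq_iff)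
    finally have "integral {0..1} (\<lambda>x. G (Suc l) x * fourier_char m x) =
        ?c * integral {0..1} (\<lambda>x. G l x * fourier_char m x)"
      using per[OF l] by (simp add: integral_unique)
    then show ?thesis using c by simp
  qed
  have "integral {0..1} (\<lambda>x. G 0 x * fourier_char m x) =
      (1 / ?c) ^ l * integral {0..1} (\<lambda>x. G l x * fourier_char m x)" if "l \<le> s" for l
    using that
  proof (induction l)
    case (Suc l)
    then show ?case using step[of l] by (simp add: mult.assoc)
  qed simp
  then show ?thesis by blast
qed

lemma trig_poly_energy:
  assumes J: "finite J" and inj: "inj_on m J"
  shows "l2_energy (\<lambda>x. \<Sum>j\<in>J. a j * fourier_char (m j) x) = (\<Sum>j\<in>J. (cmod (a j))\<^sup>2)"
proof -
  let ?K = "\<lambda>x. \<Sum>j\<in>J. a j * fourier_char (m j) x"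
  have "of_real ((cmod (?K x))\<^sup>2) = (\<Sum>i\<in>J. \<Sum>j\<in>J. a i * cnj (a j) * fourier_char (m i - m j) x)" for x
    unfolding complex_norm_square cnj_sum complex_cnj_mult fourier_char_cnj sum_product
      diff_conv_add_uminus fourier_char_add by (simp only: mult_ac)
  moreover have "((\<lambda>x. \<Sum>i\<in>J. \<Sum>j\<in>J. a i * cnj (a j) * fourier_char (m i - m j) x) has_integral
      (\<Sum>i\<in>J. \<Sum>j\<in>J. a i * cnj (a j) * (if m i - m j = 0 then 1 else 0))) {0..1}"
    by (intro has_integral_sum J has_integral_mult_right fourier_char_integral)
  moreover have "(\<Sum>i\<in>J. \<Sum>j\<in>J. a i * cnj (a j) * (if m i - m j = 0 then 1 else 0)) =
      (\<Sum>i\<in>J. \<Sum>j\<in>J. if i = j then a i * cnj (a j) else 0)"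
    using inj by (intro sum.cong refl) (auto simp: inj_on_def)
  moreover have "\<dots> = of_real (\<Sum>j\<in>J. (cmod (a j))\<^sup>2)"
    using J by (simp flip: complex_norm_square)
  ultimately have "((\<lambda>x. of_real ((cmod (?K x))\<^sup>2) :: complex) has_integral of_real (\<Sum>j\<in>J. (cmod (a j))\<^sup>2)) {0..1}"
    by simp
  from has_integral_Re[OF this] have "((\<lambda>x. (cmod (?K x))\<^sup>2) has_integral (\<Sum>j\<in>J. (cmod (a j))\<^sup>2)) {0..1}" by simp
  then show ?thesis unfolding l2_energy_def by (rule integral_unique)
qed

section \<open>A kernel that samples on a grid\<close>

text \<open>
  A nonnegative trigonometric polynomial of mean \<open>1\<close> that concentrates at the integers as \<open>M\<close> grows.
  Its Fourier coefficients are the quotients \<open>(2M choose r) / (2M choose M)\<close>, which lie in \<open>[0, 1]\<close>.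
  Positivity gives convergence for merely continuous functions, and coefficients in \<open>[0, 1]\<close> do not
  enlarge any of the \<open>L\<^sup>2\<close> bounds.
\<close>

definition peak_kernel :: "nat \<Rightarrow> real \<Rightarrow> real" where
  "peak_kernel M y = 4 ^ M / real (2 * M choose M) * cos (pi * y) ^ (2 * M)"

lemma peak_kernel_nonneg: "0 \<le> peak_kernel M y"
  unfolding peak_kernel_def by (simp add: power_mult)

text \<open>
  The binomial theorem for \<open>(e\<^bsup>i\<pi>y\<^esup> + e\<^bsup>-i\<pi>y\<^esup>)\<^bsup>2M\<^esup>\<close>. The frequency \<open>0\<close> belongs to the index \<open>r = M\<close>.
\<close>

lemma peak_kernel_expansion:
  "of_real (peak_kernel M y) =
    (\<Sum>r\<le>2 * M. of_real (real (2 * M choose r) / real (2 * M choose M)) * fourier_char (int r - int M) y)"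
proof -
  define a b :: complex where "a = exp (- \<i> * of_real (pi * y))" and "b = exp (\<i> * of_real (pi * y))"
  have ab: "a ^ r * b ^ (2 * M - r) = fourier_char (int r - int M) y" if "r \<le> 2 * M" for r
  proof -
    have "a ^ r * b ^ (2 * M - r) = exp (of_nat r * (- \<i> * of_real (pi * y)) + of_nat (2 * M - r) * (\<i> * of_real (pi * y)))"
      unfolding a_def b_def exp_add exp_of_nat_mult ..
    also have "of_nat r * (- \<i> * of_real (pi * y)) + of_nat (2 * M - r) * (\<i> * of_real (pi * y)) =
        - 2 * of_real pi * \<i> * of_int (int r - int M) * of_real y"
      using that by (simp add: of_nat_diff algebra_simps)
    finally show ?thesis unfolding fourier_char_def .
  qed
  have "a + b = of_real (2 * cos (pi * y))"
    unfolding a_def b_def by (simp add: complex_eq_iff Re_exp Im_exp)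
  then have "of_real ((2 * cos (pi * y)) ^ (2 * M)) = (a + b) ^ (2 * M)" by simp
  also have "\<dots> = (\<Sum>r\<le>2 * M. of_nat (2 * M choose r) * a ^ r * b ^ (2 * M - r))" by (rule binomial_ring)
  also have "\<dots> = (\<Sum>r\<le>2 * M. of_nat (2 * M choose r) * fourier_char (int r - int M) y)"
    using ab by (intro sum.cong) (auto simp: mult.assoc)
  finally have "of_real ((2 * cos (pi * y)) ^ (2 * M)) / of_real (real (2 * M choose M)) =
      (\<Sum>r\<le>2 * M. of_real (real (2 * M choose r) / real (2 * M choose M)) * fourier_char (int r - int M) y)"
    by (simp add: sum_divide_distrib)
  moreover have "peak_kernel M y = (2 * cos (pi * y)) ^ (2 * M) / real (2 * M choose M)"
    unfolding peak_kernel_def by (simp add: power_mult_distrib power_mult)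
  ultimately show ?thesis by simp
qed

lemma peak_kernel_integral: "(peak_kernel M has_integral 1) {0..1}"
proof -
  let ?w = "\<lambda>r. of_real (real (2 * M choose r) / real (2 * M choose M)) :: complex"
  have "((\<lambda>y. of_real (peak_kernel M y) :: complex) has_integral
      (\<Sum>r\<le>2 * M. ?w r * (if int r - int M = 0 then 1 else 0))) {0..1}"
    unfolding peak_kernel_expansion by (intro has_integral_sum has_integral_mult_right fourier_char_integral) auto
  also have "(\<Sum>r\<le>2 * M. ?w r * (if int r - int M = 0 then 1 else 0)) = (\<Sum>r\<le>2 * M. if r = M then 1 else 0)"
    by (intro sum.cong) auto
  also have "\<dots> = 1" by simp
  finally have "((\<lambda>y. of_real (peak_kernel M y) :: complex) has_integral 1) {0..1}" .
  from has_integral_Re[OF this] show ?thesis by simp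
qed

lemma peak_kernel_periodic: "peak_kernel M (y + real n) = peak_kernel M y"
proof -
  have "(of_real (peak_kernel M (y + real n)) :: complex) = of_real (peak_kernel M y)"
    unfolding peak_kernel_expansion fourier_char_periodic ..
  then show ?thesis by (simp only: of_real_eq_iff)
qed

lemma continuous_on_peak_kernel: "continuous_on A (peak_kernel M)"
  unfolding peak_kernel_def[abs_def] by (intro continuous_intros) 

text \<open>
  Away from the integers the decay of \<open>cos\<^bsup>2M\<^esup>\<close> beats the normalizing factor, which is at most \<open>2M\<close>
  because the central binomial coefficient is at least \<open>4\<^sup>M / (2M)\<close>.
\<close>

lemma peak_kernel_le:
  assumes "M > 0" "0 \<le> \<eta>" "\<eta> \<le> y" "y \<le> 1 - \<eta>"
  shows "peak_kernel M y \<le> 2 * (real M * ((cos (pi * \<eta>))\<^sup>2) ^ M)"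
proof -
  have "\<bar>cos (pi * y)\<bar> \<le> cos (pi * \<eta>)"
  proof (rule abs_leI)
    show "cos (pi * y) \<le> cos (pi * \<eta>)" using assms by (intro cos_monotone_0_pi_le) auto
    have "- cos (pi * y) = cos (pi * (1 - y))" by (simp add: right_diff_distrib cos_diff)
    also have "\<dots> \<le> cos (pi * \<eta>)" using assms by (intro cos_monotone_0_pi_le) auto
    finally show "- cos (pi * y) \<le> cos (pi * \<eta>)" .
  qed
  from power_mono[OF this abs_ge_zero, of 2] have "(cos (pi * y))\<^sup>2 \<le> (cos (pi * \<eta>))\<^sup>2"
    by (simp only: power2_abs)
  from power_mono[OF this zero_le_power2, of M]
  have 1: "cos (pi * y) ^ (2 * M) \<le> ((cos (pi * \<eta>))\<^sup>2) ^ M" by (simp only: power_mult)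
  have pos: "real (2 * M choose M) > 0" by (simp add: zero_less_binomial)
  have "4 ^ M / (2 * real M) \<le> real (2 * M choose M)" using central_binomial_lower_bound[OF assms(1)] .
  then have 2: "4 ^ M / real (2 * M choose M) \<le> 2 * real M" using pos assms(1) by (simp add: field_simps)
  have "peak_kernel M y \<le> (2 * real M) * ((cos (pi * \<eta>))\<^sup>2) ^ M"
    unfolding peak_kernel_def using 1 2 by (intro mult_mono) (auto simp: power_mult)
  then show ?thesis by simp
qed

lemma peak_kernel_tendsto:
  fixes U :: "real \<Rightarrow> complex"
  assumes U: "continuous_on {0..1} U" and per: "U 0 = U 1"
  shows "(\<lambda>M. integral {0..1} (\<lambda>y. U y * of_real (peak_kernel M y))) \<longlonglongrightarrow> U 0"
proof (rule LIMSEQ_I)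
  fix \<epsilon> :: real assume "\<epsilon> > 0"
  obtain B where B: "\<And>y. y \<in> {0..1} \<Longrightarrow> cmod (U y) \<le> B"
    using compact_imp_bounded[OF compact_continuous_image[OF U]] unfolding bounded_iff by (metis compact_Icc imageI)
  obtain d0 where d0: "d0 > 0" "\<And>y. y \<in> {0..1} \<Longrightarrow> dist y 0 < d0 \<Longrightarrow> dist (U y) (U 0) < \<epsilon> / 2"
    using U \<open>\<epsilon> > 0\<close> unfolding continuous_on_iff by (metis atLeastAtMost_iff half_gt_zero order_refl zero_le_one)
  obtain d1 where d1: "d1 > 0" "\<And>y. y \<in> {0..1} \<Longrightarrow> dist y 1 < d1 \<Longrightarrow> dist (U y) (U 1) < \<epsilon> / 2"
    using U \<open>\<epsilon> > 0\<close> unfolding continuous_on_iff by (metis atLeastAtMost_iff half_gt_zero order_refl zero_le_one)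
  (* On [0, \<eta>] and [1 - \<eta>, 1] the function U is within \<epsilon>/2 of U 0 = U 1; on the rest the
     kernel is uniformly small. *)
  define \<eta> where "\<eta> = Min {d0, d1, 1/2} / 2"
  have \<eta>: "0 < \<eta>" "\<eta> < d0" "\<eta> < d1" "\<eta> < 1/2" unfolding \<eta>_def using d0(1) d1(1) by (auto simp: min_def)
  define c where "c = (cos (pi * \<eta>))\<^sup>2"
  have "0 < pi * \<eta>" "pi * \<eta> < pi / 2" using \<eta> by auto
  then have "0 < cos (pi * \<eta>)" "cos (pi * \<eta>) < 1"
    using cos_gt_zero cos_monotone_0_pi[of 0 "pi * \<eta>"] pi_gt_zero by (auto simp del: pi_gt_zero)
  then have c: "0 \<le> c" "c < 1" unfolding c_def by (auto simp: power_less_one_iff abs_square_less_1)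
  have "(\<lambda>M. (2 * B) * (2 * (real M * c ^ M))) \<longlonglongrightarrow> (2 * B) * (2 * 0)"
    using c by (intro tendsto_intros powser_times_n_limit_0) auto
  then have "\<forall>\<^sub>F M in sequentially. (2 * B) * (2 * (real M * c ^ M)) < \<epsilon> / 2"
    by (rule order_tendstoD) (use \<open>\<epsilon> > 0\<close> in auto)
  then obtain M0 where M0: "\<And>M. M \<ge> M0 \<Longrightarrow> (2 * B) * (2 * (real M * c ^ M)) < \<epsilon> / 2"
    unfolding eventually_sequentially by blast
  show "\<exists>M1. \<forall>M\<ge>M1. norm (integral {0..1} (\<lambda>y. U y * of_real (peak_kernel M y)) - U 0) < \<epsilon>"
  proof (intro exI[of _ "max M0 1"] allI impI)
    fix M assume "max M0 1 \<le> M"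
    then have M: "M0 \<le> M" "M > 0" by auto
    define \<rho> where "\<rho> = 2 * (real M * c ^ M)"
    have \<rho>: "\<rho> \<ge> 0" using c unfolding \<rho>_def by simp
    have B0: "B \<ge> 0" using B[of 0] norm_ge_zero[of "U 0"] by (simp del: norm_ge_zero)
    have pt: "cmod (U y * of_real (peak_kernel M y) - U 0 * of_real (peak_kernel M y)) \<le>
        \<epsilon> / 2 * peak_kernel M y + (2 * B) * \<rho>" if y: "y \<in> {0..1}" for y
    proof -
      have eq: "cmod (U y * of_real (peak_kernel M y) - U 0 * of_real (peak_kernel M y)) =
          cmod (U y - U 0) * peak_kernel M y"
        unfolding left_diff_distrib[symmetric] norm_mult using peak_kernel_nonneg by simp
      show ?thesis
      proof (cases "y < \<eta> \<or> y > 1 - \<eta>")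
        case True
        then have "cmod (U y - U 0) \<le> \<epsilon> / 2"
          using d0(2)[of y] d1(2)[of y] y \<eta> per by (auto simp: dist_norm)
        then have "cmod (U y - U 0) * peak_kernel M y \<le> \<epsilon> / 2 * peak_kernel M y"
          using peak_kernel_nonneg by (intro mult_right_mono)
        moreover have "0 \<le> (2 * B) * \<rho>" using B0 \<rho> by simp
        ultimately show ?thesis unfolding eq by linarith
      next
        case False
        have "cmod (U y - U 0) \<le> 2 * B"
          using norm_triangle_ineq4[of "U y" "U 0"] B[OF y] B[of 0] by simp
        moreover have "peak_kernel M y \<le> \<rho>"
          unfolding \<rho>_def c_def using False \<eta> M by (intro peak_kernel_le) auto
        ultimately have "cmod (U y - U 0) * peak_kernel M y \<le> (2 * B) * \<rho>"
          using peak_kernel_nonneg B0 by (intro mult_mono) auto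
        moreover have "0 \<le> \<epsilon> / 2 * peak_kernel M y" using \<open>\<epsilon> > 0\<close> peak_kernel_nonneg by simp
        ultimately show ?thesis unfolding eq by linarith
      qed
    qed
    have i1: "(\<lambda>y. U y * of_real (peak_kernel M y)) integrable_on {0..1}"
      by (intro integrable_continuous_interval continuous_intros U continuous_on_peak_kernel)
    have i2: "((\<lambda>y. U 0 * of_real (peak_kernel M y)) has_integral U 0) {0..1}"
      using has_integral_mult_right[OF has_integral_of_real[OF peak_kernel_integral[of M]], of "U 0"] by simp
    have i3: "((\<lambda>y::real. \<epsilon> / 2 * peak_kernel M y + (2 * B) * \<rho>) has_integral (\<epsilon> / 2 * 1 + (2 * B) * \<rho>)) {0..1}"
      using has_integral_add[OF has_integral_mult_right[OF peak_kernel_integral, of "\<epsilon> / 2"]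
          has_integral_const_real[of "(2 * B) * \<rho>" 0 1]] by simp
    have "integral {0..1} (\<lambda>y. U y * of_real (peak_kernel M y)) - U 0 =
        integral {0..1} (\<lambda>y. U y * of_real (peak_kernel M y) - U 0 * of_real (peak_kernel M y))"
      using has_integral_diff[OF integrable_integral[OF i1] i2] by (simp add: integral_unique)
    also have "cmod \<dots> \<le> integral {0..1} (\<lambda>y. \<epsilon> / 2 * peak_kernel M y + (2 * B) * \<rho>)"
      using i1 i2 i3 pt by (intro Henstock_Kurzweil_Integration.integral_norm_bound_integral integrable_diff) auto
    also have "\<dots> = \<epsilon> / 2 + (2 * B) * \<rho>" using i3 by (simp add: integral_unique)
    also have "\<dots> < \<epsilon>" using M0[OF M(1)] unfolding \<rho>_def by simp
    finally show "norm (integral {0..1} (\<lambda>y. U y * of_real (peak_kernel M y)) - U 0) < \<epsilon>" .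
  qed
qed

text \<open>
  Folding \<open>[0, 1]\<close> onto one cell of the grid with \<open>N\<close> cells.
\<close>

lemma integral_subdivide:
  fixes g :: "real \<Rightarrow> complex"
  assumes g: "continuous_on {0..1} g" and N: "N > 0"
  shows "integral {0..1} g = (1 / of_nat N) * integral {0..1} (\<lambda>y. \<Sum>j<N. g ((y + real j) / real N))"
proof -
  define \<Phi> where "\<Phi> = (\<lambda>x. integral {0..x} g)"
  have \<Phi>: "(\<Phi> has_vector_derivative g x) (at x within {0..1})" if "x \<in> {0..1}" for x
    unfolding \<Phi>_def using integral_has_vector_derivative[OF g that] .
  have "((\<lambda>y. g ((y + real j) / real N)) has_integral
      (of_nat N * (\<Phi> (real (Suc j) / real N) - \<Phi> (real j / real N)))) {0..1}" if j: "j < N" for j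
  proof -
    have in01: "(y + real j) / real N \<in> {0..1}" if "y \<in> {0..1}" for y
      using that j by (auto simp: divide_simps)
    have "((\<lambda>y. of_nat N * \<Phi> ((y + real j) / real N)) has_vector_derivative g ((y + real j) / real N)) (at y within {0..1})"
      if y: "y \<in> {0..1}" for y
    proof -
      have lin: "((\<lambda>y. (y + real j) / real N) has_vector_derivative 1 / real N) (at y within {0..1})"
        unfolding has_real_derivative_iff_has_vector_derivative[symmetric] using N by (auto intro!: derivative_eq_intros)
      have "(\<Phi> has_vector_derivative g ((y + real j) / real N))
          (at ((y + real j) / real N) within (\<lambda>y. (y + real j) / real N) ` {0..1})"
        using in01 by (intro has_vector_derivative_within_subset[OF \<Phi>[OF in01[OF y]]]) auto
      from has_vector_derivative_mult_right[OF vector_diff_chain_within[OF lin this], of "of_nat N"]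
      show ?thesis using N by (simp add: o_def scaleR_conv_of_real)
    qed
    from fundamental_theorem_of_calculus[OF zero_le_one this]
    show ?thesis by (simp add: right_diff_distrib add.commute)
  qed
  then have "((\<lambda>y. \<Sum>j<N. g ((y + real j) / real N)) has_integral
      (\<Sum>j<N. of_nat N * (\<Phi> (real (Suc j) / real N) - \<Phi> (real j / real N)))) {0..1}"
    by (intro has_integral_sum) auto
  moreover have "(\<Sum>j<N. of_nat N * (\<Phi> (real (Suc j) / real N) - \<Phi> (real j / real N))) =
      of_nat N * (\<Phi> (real N / real N) - \<Phi> (real 0 / real N))"
    using sum_lessThan_telescope[of "\<lambda>j. \<Phi> (real j / real N)" N] by (simp flip: sum_distrib_left)
  moreover have "\<Phi> (real N / real N) - \<Phi> (real 0 / real N) = integral {0..1} g"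
    using N unfolding \<Phi>_def by simp
  ultimately show ?thesis using N by (simp add: integral_unique)
qed

text \<open>
  The kernel \<open>peak_kernel M (N x)\<close> concentrates at the grid points \<open>j / N\<close>. After folding, the claim is
  the convergence at \<open>0\<close> for the sum of the \<open>N\<close> pieces of \<open>u\<close>, which is periodic because the
  differences of its end values telescope to \<open>u 1 - u 0\<close>.
\<close>

lemma sampling_tendsto:
  fixes u :: "real \<Rightarrow> complex"
  assumes u: "continuous_on {0..1} u" and per: "u 0 = u 1" and N: "N > 0"
  shows "(\<lambda>M. integral {0..1} (\<lambda>x. u x * of_real (peak_kernel M (real N * x))))
    \<longlonglongrightarrow> 1 / of_nat N * (\<Sum>j=1..N. u (real j / real N))"
proof -
  define U where "U = (\<lambda>y. \<Sum>j<N. u ((y + real j) / real N))"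
  have Ucont: "continuous_on {0..1} U"
    unfolding U_def
    by (intro continuous_on_sum continuous_on_compose2[OF u] continuous_intros) (use N in \<open>auto simp: divide_simps\<close>)
  have U1: "U 1 = (\<Sum>j=1..N. u (real j / real N))"
    unfolding U_def by (rule sum.reindex_bij_witness[of _ "\<lambda>j. j - 1" Suc]) (auto simp: add.commute)
  have "U 1 - U 0 = (\<Sum>j<N. u (real (Suc j) / real N) - u (real j / real N))"
    unfolding U_def by (simp add: sum_subtractf add.commute)
  also have "\<dots> = u (real N / real N) - u (real 0 / real N)" by (rule sum_lessThan_telescope)
  also have "\<dots> = 0" using per N by simp
  finally have U01: "U 0 = U 1" by simp
  have "integral {0..1} (\<lambda>x. u x * of_real (peak_kernel M (real N * x))) =
      1 / of_nat N * integral {0..1} (\<lambda>y. U y * of_real (peak_kernel M y))" for M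
  proof -
    have "continuous_on {0..1} (\<lambda>x. u x * of_real (peak_kernel M (real N * x)))"
      by (intro continuous_intros u continuous_on_compose2[OF continuous_on_peak_kernel[of UNIV]]) auto
    from integral_subdivide[OF this N]
    have "integral {0..1} (\<lambda>x. u x * of_real (peak_kernel M (real N * x))) = 1 / of_nat N *
        integral {0..1} (\<lambda>y. \<Sum>j<N. u ((y + real j) / real N) * of_real (peak_kernel M (y + real j)))"
      using N by simp
    then show ?thesis unfolding peak_kernel_periodic U_def sum_distrib_right .
  qed
  then show ?thesis
    using tendsto_mult_left[OF peak_kernel_tendsto[OF Ucont U01], of "1 / of_nat N"] unfolding U01[symmetric] U1[symmetric] by simp
qed

section \<open>Aliasing\<close>

text \<open>
  Telescoping comparison with \<open>1 / (M (M + 1))\<close>; the sharper bound \<open>2 - 1 / M\<close> is what the induction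
  can carry.
\<close>

lemma odd_reciprocal_squares_le: "(\<Sum>i=1..M. 1 / (2 * real i - 1)\<^sup>2) \<le> 2"
proof (cases "M = 0")
  case False
  then have "1 \<le> M" by simp
  then have "(\<Sum>i=1..M. 1 / (2 * real i - 1)\<^sup>2) \<le> 2 - 1 / real M"
  proof (induction M rule: nat_induct_at_least)
    case (Suc M)
    have "1 / (2 * real (Suc M) - 1)\<^sup>2 \<le> 1 / (real M * real (Suc M))"
    proof (rule divide_left_mono)
      show "real M * real (Suc M) \<le> (2 * real (Suc M) - 1)\<^sup>2"
        by (simp add: power2_eq_square algebra_simps)
      show "0 < (2 * real (Suc M) - 1)\<^sup>2 * (real M * real (Suc M))"
        using Suc.hyps by (intro mult_pos_pos zero_less_power) auto
    qed simp
    also have "\<dots> = 1 / real M - 1 / real (Suc M)" using Suc.hyps by (simp add: field_simps)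
    finally show ?case using Suc by simp
  qed simp
  then show ?thesis by (rule order_trans) simp
qed simp

text \<open>
  When the grid resolves the frequency \<open>k\<close>, that is \<open>2 |k| \<le> N\<close>, the aliases satisfy
  \<open>|k + j N| \<ge> (N + |k|) (2 |j| - 1) / 3\<close>. Equality holds for \<open>|k| = N / 2\<close> and the nearest
  alias \<open>- k\<close>, which is why the constant \<open>3 / (2 \<pi>)\<close> appears in the error bound.
\<close>

lemma alias_frequency_le:
  assumes N: "2 * \<bar>k\<bar> \<le> int N" "0 < N" and j: "j \<noteq> 0"
  shows "1 / (2 * pi * real_of_int \<bar>k + j * int N\<bar>) \<le>
    3 / (2 * pi * (real N + real_of_int \<bar>k\<bar>)) * (1 / (2 * real_of_int \<bar>j\<bar> - 1))"
proof -
  have j1: "\<bar>j\<bar> \<ge> 1" using j by simp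
  (* The slack in the claimed inequality, written as a product of nonnegative factors. *)
  have "(int N + \<bar>k\<bar>) * (2 * \<bar>j\<bar> - 1) + (\<bar>j\<bar> + 1) * (int N - 2 * \<bar>k\<bar>) = 3 * (\<bar>j\<bar> * int N - \<bar>k\<bar>)"
    by (simp add: algebra_simps)
  moreover have "0 \<le> (\<bar>j\<bar> + 1) * (int N - 2 * \<bar>k\<bar>)" using N by simp
  moreover have "\<bar>j\<bar> * int N - \<bar>k\<bar> \<le> \<bar>k + j * int N\<bar>"
    using abs_triangle_ineq2_sym[of "- (j * int N)" k] by (simp add: abs_mult)
  moreover have "A \<le> 3 * Q" if "A + B = 3 * P" "0 \<le> B" "P \<le> Q" for A B P Q :: int using that by linarith
  ultimately have "(int N + \<bar>k\<bar>) * (2 * \<bar>j\<bar> - 1) \<le> 3 * \<bar>k + j * int N\<bar>" by blast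
  then have le: "(real N + real_of_int \<bar>k\<bar>) * (2 * real_of_int \<bar>j\<bar> - 1) \<le> 3 * real_of_int \<bar>k + j * int N\<bar>"
    unfolding of_int_le_iff[symmetric, where 'a = real] by simp
  have pos: "0 < (real N + real_of_int \<bar>k\<bar>) * (2 * real_of_int \<bar>j\<bar> - 1)"
    using N j1 by (intro mult_pos_pos) (auto intro: add_pos_nonneg)
  have "1 / (2 * pi * real_of_int \<bar>k + j * int N\<bar>) = 3 / (2 * pi) / (3 * real_of_int \<bar>k + j * int N\<bar>)" by simp
  also have "\<dots> \<le> 3 / (2 * pi) / ((real N + real_of_int \<bar>k\<bar>) * (2 * real_of_int \<bar>j\<bar> - 1))"
    by (rule divide_left_mono[OF le _ mult_pos_pos[OF less_le_trans[OF pos le] pos]]) simp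
  finally show ?thesis by (simp add: mult.assoc)
qed

text \<open>
  The aliases with \<open>|j| = i\<close> come in pairs, and the \<open>2 s\<close>-th power of \<open>1 / (2 i - 1) \<le> 1\<close> is at
  most its square, so the bound is reduced to a sum of reciprocal odd squares.
\<close>

lemma alias_sum_le:
  assumes N: "2 * \<bar>k\<bar> \<le> int N" "0 < N" and s: "1 \<le> s"
  shows "(\<Sum>r\<in>{..2 * M} - {M}. (1 / (2 * pi * real_of_int \<bar>k + (int r - int M) * int N\<bar>)) ^ (2 * s)) \<le>
    4 * (3 / (2 * pi * (real N + real_of_int \<bar>k\<bar>))) ^ (2 * s)"
proof -
  define \<beta> where "\<beta> = 3 / (2 * pi * (real N + real_of_int \<bar>k\<bar>))"
  have \<beta>: "0 \<le> \<beta>" unfolding \<beta>_def by simp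
  let ?q = "\<lambda>i. 1 / (2 * real i - 1)\<^sup>2"
  have alias_le: "(1 / (2 * pi * real_of_int \<bar>k + (int r - int M) * int N\<bar>)) ^ (2 * s) \<le> \<beta> ^ (2 * s) * ?q i"
    if i: "\<bar>int r - int M\<bar> = int i" "i \<ge> 1" for r i
  proof -
    have "1 / (2 * pi * real_of_int \<bar>k + (int r - int M) * int N\<bar>) \<le> \<beta> * (1 / (2 * real i - 1))"
      using alias_frequency_le[OF N, of "int r - int M"] i unfolding \<beta>_def by auto
    then have "(1 / (2 * pi * real_of_int \<bar>k + (int r - int M) * int N\<bar>)) ^ (2 * s) \<le> (\<beta> * (1 / (2 * real i - 1))) ^ (2 * s)"
      by (intro power_mono) auto
    also have "\<dots> = \<beta> ^ (2 * s) * (1 / (2 * real i - 1)) ^ (2 * s)" by (rule power_mult_distrib)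
    also have "\<dots> \<le> \<beta> ^ (2 * s) * (1 / (2 * real i - 1)) ^ 2"
      using i s \<beta> by (intro mult_left_mono power_decreasing) auto
    finally show ?thesis by (simp add: power_divide)
  qed
  have "(\<Sum>r\<in>{..2 * M} - {M}. (1 / (2 * pi * real_of_int \<bar>k + (int r - int M) * int N\<bar>)) ^ (2 * s)) \<le>
      (\<Sum>r\<in>{..2 * M} - {M}. \<beta> ^ (2 * s) * ?q (nat \<bar>int r - int M\<bar>))"
    by (intro sum_mono alias_le) auto
  also have "(\<Sum>r\<in>{..2 * M} - {M}. \<beta> ^ (2 * s) * ?q (nat \<bar>int r - int M\<bar>)) =
      (\<Sum>r<M. \<beta> ^ (2 * s) * ?q (nat \<bar>int r - int M\<bar>)) + (\<Sum>r\<in>{M<..2 * M}. \<beta> ^ (2 * s) * ?q (nat \<bar>int r - int M\<bar>))"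
  proof -
    have halves: "{..2 * M} - {M} = {..<M} \<union> {M<..2 * M}" by auto
    show ?thesis unfolding halves by (intro sum.union_disjoint) auto
  qed
  also have "(\<Sum>r<M. \<beta> ^ (2 * s) * ?q (nat \<bar>int r - int M\<bar>)) = (\<Sum>i=1..M. \<beta> ^ (2 * s) * ?q i)"
    proof (rule sum.reindex_bij_witness[of _ "\<lambda>i. M - i" "\<lambda>r. M - r"])
    fix r assume "r \<in> {..<M}"
    then have "nat \<bar>int r - int M\<bar> = M - r" by simp
    then show "\<beta> ^ (2 * s) * ?q (M - r) = \<beta> ^ (2 * s) * ?q (nat \<bar>int r - int M\<bar>)" by (simp only:)
  qed auto
  also have "(\<Sum>r\<in>{M<..2 * M}. \<beta> ^ (2 * s) * ?q (nat \<bar>int r - int M\<bar>)) = (\<Sum>i=1..M. \<beta> ^ (2 * s) * ?q i)"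
    proof (rule sum.reindex_bij_witness[of _ "\<lambda>i. M + i" "\<lambda>r. r - M"])
    fix r assume "r \<in> {M<..2 * M}"
    then have "nat \<bar>int r - int M\<bar> = r - M" by auto
    then show "\<beta> ^ (2 * s) * ?q (r - M) = \<beta> ^ (2 * s) * ?q (nat \<bar>int r - int M\<bar>)" by (simp only:)
  qed auto
  also have "(\<Sum>i=1..M. \<beta> ^ (2 * s) * ?q i) + (\<Sum>i=1..M. \<beta> ^ (2 * s) * ?q i) = \<beta> ^ (2 * s) * (2 * (\<Sum>i=1..M. ?q i))"
    by (simp only: sum_distrib_left[symmetric] mult_2 distrib_left)
  also have "\<dots> \<le> \<beta> ^ (2 * s) * (2 * 2)"
    using odd_reciprocal_squares_le[of M] \<beta> by (intro mult_left_mono) auto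
  finally show ?thesis unfolding \<beta>_def by (simp add: mult.commute)
qed

text \<open>
  Multiplying by the kernel at \<open>N x\<close> adds to the \<open>k\<close>-th Fourier coefficient damped versions of the
  coefficients at the aliases \<open>k + j N\<close>. Each of these is a Fourier coefficient of \<open>G s\<close> divided by
  \<open>(2 \<pi> i (k + j N))\<^sup>s\<close>, so the difference is the integral of \<open>G s\<close> against a trigonometric
  polynomial \<open>K\<close> whose \<open>L\<^sup>2\<close> norm is controlled by the sum over the aliases. The bound does not depend
  on \<open>M\<close>.
\<close>

lemma filtered_alias_error:
  assumes G: "sobolev_chain s G" and per: "\<And>l. l < s \<Longrightarrow> G l 0 = G l 1" and s: "1 \<le> s"
    and E: "l2_energy (G s) \<le> 1" and N: "2 * \<bar>k\<bar> \<le> int N" "0 < N"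
  shows "cmod (integral {0..1} (\<lambda>x. G 0 x * fourier_char k x) -
      integral {0..1} (\<lambda>x. (G 0 x * fourier_char k x) * of_real (peak_kernel M (real N * x)))) \<le>
    2 * (3 / (2 * pi * (real N + real_of_int \<bar>k\<bar>))) ^ s"
proof -
  note ch = sobolev_chainD[OF G]
  let ?J = "{..2 * M} - {M}"
  define w where "w = (\<lambda>r. real (2 * M choose r) / real (2 * M choose M))"
  define m where "m = (\<lambda>r. k + (int r - int M) * int N)"
  define a where "a = (\<lambda>r. of_real (w r) * (1 / (2 * of_real pi * \<i> * of_int (m r))) ^ s)"
  define K where "K = (\<lambda>x. \<Sum>r\<in>?J. a r * fourier_char (m r) x)"
  have G0: "continuous_on {0..1} (G 0)" using ch(3)[of 0] s by simp
  have choose_pos: "real (2 * M choose M) > 0" by (simp add: zero_less_binomial)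
  have w: "0 \<le> w r" "w r \<le> 1" for r
    unfolding w_def using binomial_maximum'[of M r] choose_pos by (auto simp: divide_le_eq_1)
  have wM: "w M = 1" unfolding w_def using choose_pos by simp
  (* An alias cannot be the zero frequency, because |k| < N. *)
  have m0: "m r \<noteq> 0" if "r \<in> ?J" for r
  proof
    assume "m r = 0"
    then have "\<bar>k\<bar> = \<bar>(int r - int M) * int N\<bar>" unfolding m_def by linarith
    then have "\<bar>k\<bar> = \<bar>int r - int M\<bar> * int N" by (simp add: abs_mult)
    moreover have "1 * int N \<le> \<bar>int r - int M\<bar> * int N" using that by (intro mult_right_mono) auto
    ultimately show False using N by linarith
  qed
  have "inj m" unfolding m_def inj_on_def using N by auto
  then have inj: "inj_on m ?J" by (rule inj_on_subset) simp
  have expand: "(G 0 x * fourier_char k x) * of_real (peak_kernel M (real N * x)) =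
      G 0 x * fourier_char k x + (\<Sum>r\<in>?J. of_real (w r) * (G 0 x * fourier_char (m r) x))" for x
  proof -
    have "(G 0 x * fourier_char k x) * of_real (peak_kernel M (real N * x)) =
        (\<Sum>r\<le>2 * M. of_real (w r) * (G 0 x * fourier_char (m r) x))"
      unfolding peak_kernel_expansion sum_distrib_left w_def m_def fourier_char_add fourier_char_mult_nat
      by (simp only: mult_ac)
    also have "\<dots> = of_real (w M) * (G 0 x * fourier_char (m M) x) + (\<Sum>r\<in>?J. of_real (w r) * (G 0 x * fourier_char (m r) x))"
      by (rule sum.remove) auto
    finally show ?thesis by (simp add: wM m_def)
  qed
  have int0: "(\<lambda>x. G 0 x * fourier_char i x) integrable_on {0..1}" for i
    by (intro integrable_continuous_interval continuous_intros G0)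
  have ints: "(\<lambda>x. G s x * fourier_char i x) integrable_on {0..1}" for i
    using set_lebesgue_integral_eq_integral(1)[OF square_integrable_mult[OF ch(4)[OF order_refl]
        square_integrable_continuous[OF continuous_on_fourier_char]]] .
  have "integral {0..1} (\<lambda>x. (G 0 x * fourier_char k x) * of_real (peak_kernel M (real N * x))) =
      integral {0..1} (\<lambda>x. G 0 x * fourier_char k x) +
      (\<Sum>r\<in>?J. of_real (w r) * integral {0..1} (\<lambda>x. G 0 x * fourier_char (m r) x))"
    unfolding expand
    by (intro integral_unique has_integral_add has_integral_sum has_integral_mult_right integrable_integral int0) auto
  also have "(\<Sum>r\<in>?J. of_real (w r) * integral {0..1} (\<lambda>x. G 0 x * fourier_char (m r) x)) =
      (\<Sum>r\<in>?J. a r * integral {0..1} (\<lambda>x. G s x * fourier_char (m r) x))"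
    using fourier_coefficient_chain[OF G per m0] unfolding a_def by (intro sum.cong) auto
  also have "\<dots> = integral {0..1} (\<lambda>x. \<Sum>r\<in>?J. a r * (G s x * fourier_char (m r) x))"
    by (intro integral_unique[symmetric] has_integral_sum has_integral_mult_right integrable_integral ints) auto
  also have "(\<lambda>x. \<Sum>r\<in>?J. a r * (G s x * fourier_char (m r) x)) = (\<lambda>x. G s x * K x)"
    unfolding K_def sum_distrib_left by (simp only: mult_ac)
  finally have "cmod (integral {0..1} (\<lambda>x. G 0 x * fourier_char k x) -
      integral {0..1} (\<lambda>x. (G 0 x * fourier_char k x) * of_real (peak_kernel M (real N * x)))) =
      cmod (integral {0..1} (\<lambda>x. G s x * K x))" by (simp add: norm_minus_commute)
  also have "\<dots> \<le> sqrt (l2_energy (G s) * l2_energy K)"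
  proof (rule l2_Cauchy_Schwarz_product[OF ch(4)[OF order_refl]])
    show "square_integrable K"
      unfolding K_def by (intro square_integrable_continuous continuous_intros)
  qed
  also have "\<dots> \<le> sqrt (1 * (4 * (3 / (2 * pi * (real N + real_of_int \<bar>k\<bar>))) ^ (2 * s)))"
  proof (intro real_sqrt_le_mono mult_mono E)
    have "l2_energy K = (\<Sum>r\<in>?J. (cmod (a r))\<^sup>2)"
      unfolding K_def by (rule trig_poly_energy[OF _ inj]) simp
    also have "\<dots> \<le> (\<Sum>r\<in>?J. (1 / (2 * pi * real_of_int \<bar>k + (int r - int M) * int N\<bar>)) ^ (2 * s))"
    proof (rule sum_mono)
      fix r
      have "cmod (a r) = w r * (1 / (2 * pi * real_of_int \<bar>m r\<bar>)) ^ s"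
        unfolding a_def using w by (simp add: norm_mult norm_power norm_divide)
      also have "\<dots> \<le> 1 * (1 / (2 * pi * real_of_int \<bar>m r\<bar>)) ^ s"
        using w by (intro mult_right_mono) auto
      finally have "(cmod (a r))\<^sup>2 \<le> ((1 / (2 * pi * real_of_int \<bar>m r\<bar>)) ^ s)\<^sup>2" by (intro power_mono) auto
      then show "(cmod (a r))\<^sup>2 \<le> (1 / (2 * pi * real_of_int \<bar>k + (int r - int M) * int N\<bar>)) ^ (2 * s)"
        unfolding m_def by (simp only: power_mult[symmetric] mult.commute)
    qed
    also have "\<dots> \<le> 4 * (3 / (2 * pi * (real N + real_of_int \<bar>k\<bar>))) ^ (2 * s)"
      by (rule alias_sum_le[OF N s])
    finally show "l2_energy K \<le> 4 * (3 / (2 * pi * (real N + real_of_int \<bar>k\<bar>))) ^ (2 * s)" .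
  qed auto
  also have "\<dots> = 2 * (3 / (2 * pi * (real N + real_of_int \<bar>k\<bar>))) ^ s"
  proof -
    let ?\<beta> = "3 / (2 * pi * (real N + real_of_int \<bar>k\<bar>))"
    have "1 * (4 * ?\<beta> ^ (2 * s)) = (2 * ?\<beta> ^ s)\<^sup>2"
      by (simp only: power_mult_distrib power_mult[symmetric] mult.commute[of s]) simp
    moreover have "0 \<le> 2 * ?\<beta> ^ s" by simp
    ultimately show ?thesis by (simp only: real_sqrt_unique)
  qed
  finally show ?thesis .
qed

text \<open>
  If the grid resolves \<open>k\<close>, let \<open>M\<close> tend to infinity in the previous lemma. Otherwise the rule returns
  \<open>0\<close>, the error is the Fourier coefficient itself, and \<open>N < 2 |k|\<close> gives \<open>N + |k| \<le> 3 |k|\<close>.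
\<close>

lemma periodic_algorithm_error:
  assumes G: "sobolev_chain s G" and per: "\<And>l. l < s \<Longrightarrow> G l 0 = G l 1" and s: "1 \<le> s"
    and E: "l2_energy (G s) \<le> 1" and N: "0 < N"
  shows "cmod (integral {0..1} (\<lambda>x. G 0 x * fourier_char k x) - periodic_alg k N (G 0)) \<le>
    2 * (3 / (2 * pi * (real N + real_of_int \<bar>k\<bar>))) ^ s"
proof (cases "2 * \<bar>k\<bar> \<le> int N")
  case True
  note ch = sobolev_chainD[OF G]
  let ?u = "\<lambda>x. G 0 x * fourier_char k x"
  have "continuous_on {0..1} ?u" using ch(3)[of 0] s by (intro continuous_intros) auto
  moreover have "?u 0 = ?u 1" using per[of 0] s by simp
  ultimately have "(\<lambda>M. integral {0..1} (\<lambda>x. ?u x * of_real (peak_kernel M (real N * x))))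
      \<longlonglongrightarrow> 1 / of_nat N * (\<Sum>j=1..N. ?u (real j / real N))"
    by (rule sampling_tendsto[OF _ _ N])
  also have "1 / of_nat N * (\<Sum>j=1..N. ?u (real j / real N)) = periodic_alg k N (G 0)"
    using True N unfolding periodic_alg_def fourier_char_def by simp
  finally have "(\<lambda>M. cmod (integral {0..1} ?u - integral {0..1} (\<lambda>x. ?u x * of_real (peak_kernel M (real N * x)))))
      \<longlonglongrightarrow> cmod (integral {0..1} ?u - periodic_alg k N (G 0))"
    by (intro tendsto_intros)
  then show ?thesis
    by (rule LIMSEQ_le_const2) (use filtered_alias_error[OF G per s E True N] in blast)
next
  case False
  note ch = sobolev_chainD[OF G]
  have k: "k \<noteq> 0" using False by auto
  have "cmod (integral {0..1} (\<lambda>x. G s x * fourier_char k x)) \<le> sqrt (l2_energy (G s) * l2_energy (fourier_char k))"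
    by (intro l2_Cauchy_Schwarz_product ch(4) order_refl square_integrable_continuous continuous_intros)
  also have "\<dots> \<le> 1" using E by (simp add: l2_energy_def)
  finally have c: "cmod (integral {0..1} (\<lambda>x. G s x * fourier_char k x)) \<le> 1" .
  have "periodic_alg k N (G 0) = 0" using False unfolding periodic_alg_def by simp
  then have "cmod (integral {0..1} (\<lambda>x. G 0 x * fourier_char k x) - periodic_alg k N (G 0)) =
      (1 / (2 * pi * real_of_int \<bar>k\<bar>)) ^ s * cmod (integral {0..1} (\<lambda>x. G s x * fourier_char k x))"
    using fourier_coefficient_chain[OF G per k] by (simp add: norm_mult norm_power norm_divide)
  also have "\<dots> \<le> (1 / (2 * pi * real_of_int \<bar>k\<bar>)) ^ s * 2"
    using c by (intro mult_left_mono) auto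
  also have "\<dots> \<le> (3 / (2 * pi * (real N + real_of_int \<bar>k\<bar>))) ^ s * 2"
  proof (intro mult_right_mono power_mono)
    have "1 / (2 * pi * real_of_int \<bar>k\<bar>) = 3 / (2 * pi * (3 * real_of_int \<bar>k\<bar>))" by simp
    also have "\<dots> \<le> 3 / (2 * pi * (real N + real_of_int \<bar>k\<bar>))"
      using False N k by (intro divide_left_mono mult_left_mono mult_pos_pos) auto
    finally show "1 / (2 * pi * real_of_int \<bar>k\<bar>) \<le> 3 / (2 * pi * (real N + real_of_int \<bar>k\<bar>))" .
  qed auto
  finally show ?thesis by (simp add: mult.commute)
qed

section \<open>The worst-case error\<close>

text \<open>
  In part (b) the Fourier coefficient of the periodizer enters exactly, which leaves the error of the
  periodic rule for \<open>f - periodizer s f\<close>, with \<open>N = n - 2 s + 1\<close> sample points.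
\<close>

theorem theorem14:
  fixes s :: nat and k :: int
  assumes "1 \<le> s"
  shows "(\<forall>n. 1 \<le> n \<and> n \<le> s \<longrightarrow>
            worst_error s k (tay_per s k n) \<le> ereal (1 / (2 ^ (n - 1) * fact n))) \<and>
         (\<forall>n. 2 * s \<le> n \<longrightarrow>
            worst_error s k (tay_per s k n) \<le>
              ereal ((3 / (2 * pi)) ^ s *
                     (2 / (real n - 2 * real s + 1 + real_of_int \<bar>k\<bar>) ^ s)))"
proof (intro conjI allI impI)
  fix n assume n: "1 \<le> n \<and> n \<le> s"
  show "worst_error s k (tay_per s k n) \<le> ereal (1 / (2 ^ (n - 1) * fact n))"
    unfolding worst_error_def
  proof (rule SUP_least)
    fix f assume "f \<in> {f \<in> Hspace s. Hnorm s f \<le> 1}"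
    then show "ereal (cmod (fourier_int k f - tay_per s k n f)) \<le> ereal (1 / (2 ^ (n - 1) * fact n))"
      using taylor_algorithm_error[of f s n k] n by (simp add: tay_per_def)
  qed
next
  fix n assume n: "2 * s \<le> n"
  define N where "N = n - 2 * s + 1"
  have N: "0 < N" "real N = real n - 2 * real s + 1" unfolding N_def using n by (simp_all add: of_nat_diff)
  show "worst_error s k (tay_per s k n) \<le> ereal ((3 / (2 * pi)) ^ s *
      (2 / (real n - 2 * real s + 1 + real_of_int \<bar>k\<bar>) ^ s))"
    unfolding worst_error_def
  proof (rule SUP_least)
    fix f assume "f \<in> {f \<in> Hspace s. Hnorm s f \<le> 1}"
    then have f: "f \<in> Hspace s" "Hnorm s f \<le> 1" by auto
    let ?G = "\<lambda>l x. nderiv l f x - periodizer_deriv s f l x"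
    note G = periodized_chain[OF f(1) assms]
    have contf: "continuous_on {0..1} f"
      using sobolev_chainD(3)[OF Hspace_sobolev_chain[OF f(1) assms], of 0] assms by simp
    have contp: "continuous_on {0..1} (periodizer s f)"
      unfolding periodizer_deriv_0[symmetric] using periodizer_deriv_has_derivative
      by (meson continuous_at_imp_continuous_on has_vector_derivative_continuous)
    have G0: "?G 0 = (\<lambda>x. f x - periodizer s f x)" by (simp add: periodizer_deriv_0)
    have "tay_per s k n f = fourier_int k (periodizer s f) + periodic_alg k N (?G 0)"
      using n assms unfolding tay_per_def N_def G0 by simp
    then have "fourier_int k f - tay_per s k n f =
        (fourier_int k f - fourier_int k (periodizer s f)) - periodic_alg k N (?G 0)" by simp
    also have "\<dots> = integral {0..1} (\<lambda>x. ?G 0 x * fourier_char k x) - periodic_alg k N (?G 0)"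
      using fourier_int_diff[OF contf contp, of k] by (simp add: periodizer_deriv_0)
    also have "cmod \<dots> \<le> 2 * (3 / (2 * pi * (real N + real_of_int \<bar>k\<bar>))) ^ s"
    proof (rule periodic_algorithm_error[OF G(1) _ assms _ N(1)])
      show "l2_energy (?G s) \<le> 1"
        using G(3) unit_ball_energy_le_1[OF f(1) assms f(2) order_refl] by linarith
    qed (use G(2) in blast)
    also have "\<dots> = (3 / (2 * pi)) ^ s * (2 / (real n - 2 * real s + 1 + real_of_int \<bar>k\<bar>) ^ s)"
      unfolding N(2)[symmetric] by (simp add: power_divide power_mult_distrib)
    finally show "ereal (cmod (fourier_int k f - tay_per s k n f)) \<le>
        ereal ((3 / (2 * pi)) ^ s * (2 / (real n - 2 * real s + 1 + real_of_int \<bar>k\<bar>) ^ s))" by simp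
  qed
qed

end
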